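(* Let $D_1$ and $D_2$ be link diagrams whose alternating decomposition graphs are isomorphic (as abstract multigraphs). Then $g_T(D_1)=g_T(D_2)$, where $g_T(D)$ denotes the genus of the Turaev surface of $D$.
   Context: Graphs are finite and may have multiple edges. A link diagram $D$ is viewed as a $4$-valent graph on the sphere $S^2$ with over/under information at the vertices (crossings); "edge", "face", "connected" refer to this graph. An edge of $D$ is non-alternating if both of its ends are over-strands or both are under-strands at the crossings they meet; otherwise it is alternating. A diagram is alternating if all of its edges are alternating. Alternating decomposition: for a connected diagram $D$, mark two distinct points on every non-alternating edge, and inside each face join by disjoint arcs those pairs of marked points that are adjacent along the boundary of the face but do not lie on the same edge of $D$. The arcs form pairwise disjoint simple closed curves $\gamma_1,\dots,\gamma_k$ in $S^2$. Alternating decomposition graph $G$ of $D$: if $D$ is connected and alternating, $G$ is a single vertex with no edges. If $D$ is connected and not alternating, the vertices $v_1,\dots,v_k$ of $G$ correspond to $\gamma_1,\dots,\gamma_k$, the edges of $G$ correspond to the non-alternating edges of $D$, and the edge of $G$ corresponding to a non-alternating edge of $D$ joins $v_i$ and $v_j$ where $\gamma_i,\gamma_j$ are the curves through its two marked points. If $D$ is disconnected, $G$ is the disjoint union of the alternating decomposition graphs of its connected components. Turaev surface: the all-$A$ (all-$B$) state of $D$ is the collection of simple closed curves obtained by performing the $A$-resolution (respectively $B$-resolution) at every crossing. The Turaev surface is obtained from the cobordism between the all-$B$ and all-$A$ states that has a saddle at each crossing and is a product elsewhere, by capping off all boundary components with disks. It is closed and oriented; its genus (sum of genera over components) is $g_T(D)=\frac12\bigl(2k(D)+c(D)-s_A(D)-s_B(D)\bigr)$,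 where $k(D)$ is the number of connected components of the diagram $D$ as a graph, $c(D)$ the number of crossings, and $s_A(D),s_B(D)$ the numbers of curves in the all-$A$ and all-$B$ states. *)

theory Defs
  imports Complex_Main "HOL-Combinatorics.Orbits"
begin

section \<open>Undirected multigraphs\<close>

text \<open>A loop is an edge whose set of ends is a singleton.\<close>

record ('v, 'e) multigraph =
  verts :: "'v set"
  edges :: "'e set"
  ends :: "'e \<Rightarrow> 'v set"

definition multigraph_iso ::
    "('v, 'e) multigraph \<Rightarrow> ('w, 'f) multigraph \<Rightarrow> bool" where
  "multigraph_iso G H \<longleftrightarrow>
    (\<exists>\<phi> \<psi>. bij_betw \<phi> (verts G) (verts H) \<and> bij_betw \<psi> (edges G) (edges H) \<and>
      (\<forall>e\<in>edges G. ends H (\<psi> e) = \<phi> ` ends G e))"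

definition disjoint_union ::
    "'i set \<Rightarrow> ('i \<Rightarrow> ('v, 'e) multigraph) \<Rightarrow> ('i \<times> 'v, 'i \<times> 'e) multigraph" where
  "disjoint_union I G =
    \<lparr>verts = (SIGMA i:I. verts (G i)),
     edges = (SIGMA i:I. edges (G i)),
     ends = (\<lambda>(i, e). Pair i ` ends (G i) e)\<rparr>"


section \<open>Connectedness inside a set\<close>

definition class_of :: "'a set \<Rightarrow> ('a \<Rightarrow> 'a \<Rightarrow> bool) \<Rightarrow> 'a \<Rightarrow> 'a set" where
  "class_of S R x = {y. equivclp (\<lambda>u v. u \<in> S \<and> v \<in> S \<and> R u v) x y}"

definition classes :: "'a set \<Rightarrow> ('a \<Rightarrow> 'a \<Rightarrow> bool) \<Rightarrow> 'a set set" where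
  "classes S R = class_of S R ` S"


section \<open>Link diagrams\<close>

text \<open>
  A diagram on the oriented sphere is given by its rotation system.  A dart is an end of an edge
  at a crossing (a half-edge).  \<open>rot\<close> sends a dart to the next one counterclockwise around its
  crossing, \<open>mate\<close> sends a dart to the other end of its edge, and \<open>over\<close> holds for the darts that
  lie on the over-strand of their crossing.  \<open>circles\<close> is the number of components of the diagram
  that are simple closed curves without crossings; these carry no darts.

  For a disconnected diagram the position of the components relative to each other is not recorded.
  The alternating decomposition graph is formed component by component, and the numbers of
  components, crossings and state curves do not depend on this position.

  Walking along an edge away from the crossing of the dart \<open>d\<close> and then, keeping the same face on
  the right, turning into the next edge means passing from \<open>d\<close> to \<open>rot (mate d)\<close>; so the faces of a
  connected diagram that has a crossing are the orbits of this map.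
\<close>

record 'd diagram =
  darts :: "'d set"
  rot :: "'d \<Rightarrow> 'd"
  mate :: "'d \<Rightarrow> 'd"
  over :: "'d \<Rightarrow> bool"
  circles :: nat

definition crossings :: "'d diagram \<Rightarrow> 'd set set" where
  "crossings D = orbit (rot D) ` darts D"

definition dedges :: "'d diagram \<Rightarrow> 'd set set" where
  "dedges D = (\<lambda>d. {d, mate D d}) ` darts D"

definition face_step :: "'d diagram \<Rightarrow> 'd \<Rightarrow> 'd" where
  "face_step D d = rot D (mate D d)"

definition faces :: "'d diagram \<Rightarrow> 'd set set" where
  "faces D = orbit (face_step D) ` darts D"

text \<open>
  Connected components are indexed by their set of darts, or by a number if they are crossingless
  circles.
\<close>

definition dart_components :: "'d diagram \<Rightarrow> 'd set set" where
  "dart_components D = classes (darts D) (\<lambda>x y. y = rot D x \<or> y = mate D x)"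

definition components :: "'d diagram \<Rightarrow> ('d set + nat) set" where
  "components D = dart_components D <+> {..<circles D}"

fun component :: "'d diagram \<Rightarrow> 'd set + nat \<Rightarrow> 'd diagram" where
  "component D (Inl C) = D\<lparr>darts := C, circles := 0\<rparr>"
| "component D (Inr i) = D\<lparr>darts := {}, circles := 1\<rparr>"

text \<open>
  The last condition says that every component is drawn on the sphere (Euler's formula).
\<close>

locale link_diagram =
  fixes D :: "'d diagram"
  assumes finite_darts: "finite (darts D)"
    and rot_closed: "d \<in> darts D \<Longrightarrow> rot D d \<in> darts D"
    and rot_four: "d \<in> darts D \<Longrightarrow> (rot D ^^ 4) d = d"
    and rot_two: "d \<in> darts D \<Longrightarrow> (rot D ^^ 2) d \<noteq> d"
    and mate_closed: "d \<in> darts D \<Longrightarrow> mate D d \<in> darts D"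
    and mate_mate: "d \<in> darts D \<Longrightarrow> mate D (mate D d) = d"
    and mate_neq: "d \<in> darts D \<Longrightarrow> mate D d \<noteq> d"
    and over_rot: "d \<in> darts D \<Longrightarrow> over D (rot D d) \<longleftrightarrow> \<not> over D d"
    and spherical: "C \<in> dart_components D \<Longrightarrow>
      int (card (crossings (component D (Inl C)))) - int (card (dedges (component D (Inl C))))
        + int (card (faces (component D (Inl C)))) = 2"


section \<open>The alternating decomposition graph\<close>

text \<open>
  Since every edge has two marked points or none, the marked points are represented by darts: the
  dart \<open>d\<close> of a non-alternating edge stands for the marked point nearer to the end \<open>d\<close>.
\<close>

definition marked :: "'d diagram \<Rightarrow> 'd set" where
  "marked D = {d \<in> darts D. over D d \<longleftrightarrow> over D (mate D d)}"

definition nonalternating_edges :: "'d diagram \<Rightarrow> 'd set set" where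
  "nonalternating_edges D = (\<lambda>d. {d, mate D d}) ` marked D"

definition alternating :: "'d diagram \<Rightarrow> bool" where
  "alternating D \<longleftrightarrow> nonalternating_edges D = {}"

text \<open>
  A boundary walk of a face that passes the marked point \<open>p\<close> towards the end \<open>p\<close> of its edge next
  traverses the edges starting with \<open>rot p\<close>, \<open>face_step (rot p)\<close>, ...; the first marked dart \<open>q\<close> in
  this sequence is the next marked point.  (In the other direction, the next marked point is the
  one on the same edge.)
\<close>

definition joined :: "'d diagram \<Rightarrow> 'd \<Rightarrow> 'd \<Rightarrow> bool" where
  "joined D p q \<longleftrightarrow> p \<in> marked D \<and> q \<in> marked D \<and> q \<notin> {p, mate D p} \<and>
    (\<exists>n. q = (face_step D ^^ n) (rot D p) \<and>
      (\<forall>m<n. (face_step D ^^ m) (rot D p) \<notin> marked D))"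

text \<open>A curve is represented by the set of marked points on it.\<close>

definition curve_through :: "'d diagram \<Rightarrow> 'd \<Rightarrow> 'd set" where
  "curve_through D = class_of (marked D) (joined D)"

definition curves :: "'d diagram \<Rightarrow> 'd set set" where
  "curves D = classes (marked D) (joined D)"

text \<open>For connected diagrams; the vertex in the alternating case is an arbitrary set of darts.\<close>

definition connected_adg :: "'d diagram \<Rightarrow> ('d set, 'd set) multigraph" where
  "connected_adg D =
    (if alternating D then \<lparr>verts = {{}}, edges = {}, ends = (\<lambda>_. {})\<rparr>
     else \<lparr>verts = curves D, edges = nonalternating_edges D,
           ends = (\<lambda>e. curve_through D ` e)\<rparr>)"

definition alternating_decomposition_graph ::
    "'d diagram \<Rightarrow> (('d set + nat) \<times> 'd set, ('d set + nat) \<times> 'd set) multigraph" where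
  "alternating_decomposition_graph D =
    disjoint_union (components D) (\<lambda>i. connected_adg (component D i))"


section \<open>The genus of the Turaev surface\<close>

text \<open>
  The A-regions at a crossing are swept out by turning the over-strand counterclockwise, so they are
  the corners between \<open>d\<close> and \<open>rot d\<close> with \<open>d\<close> over.  The A-resolution merges these two regions,
  hence its arcs connect \<open>d\<close> and \<open>rot d\<close> for \<open>d\<close> under; the B-resolution does the opposite.
  A state curve is represented by the set of darts on it.
\<close>

definition A_state :: "'d diagram \<Rightarrow> 'd set set" where
  "A_state D = classes (darts D) (\<lambda>x y. y = mate D x \<or> (\<not> over D x \<and> y = rot D x))"

definition B_state :: "'d diagram \<Rightarrow> 'd set set" where
  "B_state D = classes (darts D) (\<lambda>x y. y = mate D x \<or> (over D x \<and> y = rot D x))"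

definition num_A :: "'d diagram \<Rightarrow> nat" where
  "num_A D = card (A_state D) + circles D"

definition num_B :: "'d diagram \<Rightarrow> nat" where
  "num_B D = card (B_state D) + circles D"

text \<open>
  The surface has one component for each component of \<open>D\<close>.  Its Euler characteristic is
  \<open>num_A D + num_B D - c\<close>, as each cap contributes 1 and each of the \<open>c\<close> saddles contributes -1.
\<close>

definition turaev_genus :: "'d diagram \<Rightarrow> rat" where
  "turaev_genus D =
    (2 * of_nat (card (components D)) + of_nat (card (crossings D))
      - of_nat (num_A D) - of_nat (num_B D)) / 2"

end

theory Submission
  imports Defs
begin

text \<open>
  Vectors over the field with two elements are represented by sets of edges, with symmetric
  difference as addition.  Let \<open>N\<close> be the set of non-alternating edges of \<open>D\<close> and \<open>C\<close> the cycle space of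
  \<open>D\<close>.  Since \<open>D\<close> also lies on its Turaev surface, with the state curves as face boundaries, \<open>2 g\<close> is the
  codimension in \<open>C\<close> of the span of the state curves.  This span turns out to be the radical of the form
  \<open>\<bar>x \<inter> y \<inter> N\<bar>\<close> modulo 2 on \<open>C\<close>, which is the intersection form of the Turaev surface: since the faces
  in the sphere span \<open>C\<close>, an \<open>x \<in> C\<close> is described by a labelling of the faces; it lies in the radical iff
  \<open>x \<inter> N\<close> is a cut, described by a labelling of the crossings; and the sum of the two labellings is
  constant on the state curves.  Therefore \<open>2 g\<close> is the rank of the dot product on the restriction of
  \<open>C\<close> to \<open>N\<close>, and that restriction is the cycle space of the alternating decomposition graph.
\<close>

section \<open>Linear algebra over the field with two elements\<close>

text \<open>The parity of \<open>card (w \<inter> y)\<close> is the dot product of \<open>w\<close>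
  and \<open>y\<close> as vectors over the field with two elements.\<close>

definition orth :: "'a set \<Rightarrow> 'a set set \<Rightarrow> 'a set set" where
  "orth E W = {y. y \<subseteq> E \<and> (\<forall>w\<in>W. even (card (w \<inter> y)))}"

definition subspace_of :: "'a set \<Rightarrow> 'a set set \<Rightarrow> bool" where
  "subspace_of E W \<longleftrightarrow> W \<subseteq> Pow E \<and> {} \<in> W \<and> (\<forall>x\<in>W. \<forall>y\<in>W. sym_diff x y \<in> W)"

lemma subspace_ofD:
  assumes "subspace_of E W"
  shows "W \<subseteq> Pow E" "{} \<in> W" "x \<in> W \<Longrightarrow> y \<in> W \<Longrightarrow> sym_diff x y \<in> W"
  using assms by (auto simp: subspace_of_def)

lemma finite_subspace_of: "finite E \<Longrightarrow> subspace_of E W \<Longrightarrow> finite W"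
  by (meson finite_Pow_iff finite_subset subspace_ofD(1))

lemma subspace_of_Pow: "subspace_of E (Pow E)"
  by (auto simp: subspace_of_def)

lemma even_card_sym_diff:
  assumes "finite A" "finite B"
  shows "even (card (sym_diff A B)) \<longleftrightarrow> (even (card A) \<longleftrightarrow> even (card B))"
proof -
  have "card (sym_diff A B) = card (A - B) + card (B - A)"
    using assms by (intro card_Un_disjoint) auto
  moreover have "card A = card (A - B) + card (A \<inter> B)"
    using card_Int_Diff[OF assms(1), of B] by simp
  moreover have "card B = card (B - A) + card (A \<inter> B)"
    using card_Int_Diff[OF assms(2), of A] by (simp add: Int_commute)
  ultimately show ?thesis by auto
qed

lemma sym_diff_Int: "sym_diff x y \<inter> z = sym_diff (x \<inter> z) (y \<inter> z)"
  by auto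

lemma subspace_of_orth:
  assumes "finite E"
  shows "subspace_of E (orth E W)"
proof -
  have "even (card (w \<inter> sym_diff x y))"
    if "w \<in> W" "x \<in> orth E W" "y \<in> orth E W" for w x y
  proof -
    have "finite x" "finite y"
      using that assms by (auto simp: orth_def intro: finite_subset)
    then show ?thesis
      using that even_card_sym_diff[of "x \<inter> w" "y \<inter> w"]
      by (simp add: Int_commute[of w] sym_diff_Int orth_def) (simp add: Int_commute[of _ w])
  qed
  then show ?thesis by (auto simp: subspace_of_def) (auto simp: orth_def)
qed

text \<open>If some \<open>w0\<close> in \<open>W\<close> meets \<open>y\<close> oddly, translation
  by \<open>w0\<close> permutes \<open>W\<close> and reverses every sign, so the sum equals its own
  negative.\<close>

lemma sum_signs_subspace:
  assumes "finite E" "subspace_of E W" "y \<subseteq> E"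
  shows "(\<Sum>w\<in>W. (-1) ^ card (w \<inter> y)) =
    (if \<forall>w\<in>W. even (card (w \<inter> y)) then int (card W) else 0)"
proof (cases "\<forall>w\<in>W. even (card (w \<inter> y))")
  case True
  then show ?thesis by simp
next
  case False
  then obtain w0 where w0: "w0 \<in> W" "odd (card (w0 \<inter> y))" by auto
  have fin: "finite w" if "w \<in> W" for w
    using that assms subspace_ofD(1) by (metis Pow_iff finite_subset subsetD)
  have "(\<Sum>w\<in>W. (-1) ^ card (w \<inter> y)) = (\<Sum>w\<in>W. (-1 :: int) ^ card (sym_diff w w0 \<inter> y))"
    using w0 subspace_ofD[OF assms(2)]
    by (intro sum.reindex_bij_witness[of _ "\<lambda>w. sym_diff w w0" "\<lambda>w. sym_diff w w0"])
      (auto intro!: arg_cong[of _ _ "\<lambda>w. (-1) ^ card (w \<inter> y)"])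
  also have "\<dots> = (\<Sum>w\<in>W. - ((-1 :: int) ^ card (w \<inter> y)))"
  proof (rule sum.cong)
    fix w assume "w \<in> W"
    then have "odd (card (sym_diff w w0 \<inter> y)) = even (card (w \<inter> y))"
      using w0 even_card_sym_diff[of "w \<inter> y" "w0 \<inter> y"] fin by (simp add: sym_diff_Int)
    then show "(-1) ^ card (sym_diff w w0 \<inter> y) = - ((-1 :: int) ^ card (w \<inter> y))"
      by (cases "even (card (w \<inter> y))") auto
  qed simp
  finally have "(\<Sum>w\<in>W. (-1 :: int) ^ card (w \<inter> y)) = 0" by (simp add: sum_negf)
  then show ?thesis using False by presburger
qed

text \<open>Evaluate the sum of the signs of \<open>card (w \<inter> y)\<close> over all \<open>w \<in> W\<close> and \<open>y \<subseteq> E\<close> in both orders.\<close>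

lemma card_orth:
  assumes "finite E" "subspace_of E W"
  shows "card W * card (orth E W) = 2 ^ card E"
proof -
  have fW: "finite W" using assms by (rule finite_subspace_of)
  have "(\<Sum>y\<in>Pow E. \<Sum>w\<in>W. (-1) ^ card (w \<inter> y)) =
      (\<Sum>y\<in>Pow E. if y \<in> orth E W then int (card W) else 0)"
    using assms sum_signs_subspace[of E W] by (intro sum.cong) (auto simp: orth_def)
  also have "\<dots> = (\<Sum>y\<in>orth E W. int (card W))"
    using assms(1) by (subst sum.inter_filter[symmetric])
      (auto intro!: sum.cong simp: orth_def)
  finally have 1: "(\<Sum>y\<in>Pow E. \<Sum>w\<in>W. (-1) ^ card (w \<inter> y)) = int (card W * card (orth E W))"
    by simp
  have "(\<Sum>w\<in>W. \<Sum>y\<in>Pow E. (-1) ^ card (w \<inter> y)) = (\<Sum>w\<in>W. if w = {} then int (2 ^ card E) else 0)"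
  proof (rule sum.cong)
    fix w assume "w \<in> W"
    then have "w \<subseteq> E" using subspace_ofD(1)[OF assms(2)] by auto
    \<comment> \<open>A singleton inside \<open>w\<close> has odd dot product with \<open>w\<close>,
      so only the term of the empty \<open>w\<close> survives.\<close>
    have "(\<forall>y\<in>Pow E. even (card (y \<inter> w))) \<longleftrightarrow> w = {}"
    proof
      assume *: "\<forall>y\<in>Pow E. even (card (y \<inter> w))"
      have False if "a \<in> w" for a
        using * \<open>w \<subseteq> E\<close> that bspec[OF *, of "{a}"] by auto
      then show "w = {}" by auto
    qed auto
    then show "(\<Sum>y\<in>Pow E. (-1) ^ card (w \<inter> y)) = (if w = {} then int (2 ^ card E) else 0)"
      using sum_signs_subspace[OF assms(1) subspace_of_Pow \<open>w \<subseteq> E\<close>] assms(1)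
      by (simp add: Int_commute[of w] card_Pow)
  qed simp
  also have "\<dots> = int (2 ^ card E)"
    using fW subspace_ofD(2)[OF assms(2)] by (simp add: sum.delta)
  finally show ?thesis
    using 1 by (subst (asm) sum.swap) (simp only: of_nat_eq_iff)
qed

text \<open>One inclusion is the symmetry of the dot product; \<open>card_orth\<close>, applied to
  \<open>W\<close> and to its complement, makes the cardinalities equal.\<close>

lemma orth_orth:
  assumes "finite E" "subspace_of E W"
  shows "orth E (orth E W) = W"
proof (rule card_subset_eq[symmetric])
  show "finite (orth E (orth E W))"
    using assms(1) by (auto simp: orth_def)
  show "W \<subseteq> orth E (orth E W)"
    using subspace_ofD(1)[OF assms(2)] by (auto simp: orth_def Int_commute)
  have "card W * card (orth E W) = card (orth E W) * card (orth E (orth E W))"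
    using card_orth assms subspace_of_orth by metis
  moreover have "card (orth E W) > 0"
    using subspace_ofD(2)[OF subspace_of_orth] finite_subspace_of[OF _ subspace_of_orth] assms(1)
    by (metis card_gt_0_iff empty_iff)
  ultimately show "card W = card (orth E (orth E W))" by simp
qed

lemma orth_image:
  assumes "inj_on f E" "W \<subseteq> Pow E"
  shows "orth (f ` E) ((`) f ` W) = (`) f ` orth E W"
proof -
  have "card (f ` w \<inter> f ` x) = card (w \<inter> x)" if "w \<in> W" "x \<subseteq> E" for w x
  proof -
    have "f ` w \<inter> f ` x = f ` (w \<inter> x)"
      using that assms by (intro inj_on_image_Int[symmetric]) auto
    then show ?thesis
      using that assms by (metis card_image inf.coboundedI2 inj_on_subset)
  qed
  then have eq: "f ` x \<in> orth (f ` E) ((`) f ` W) \<longleftrightarrow> x \<in> orth E W" if "x \<subseteq> E" for x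
    using that by (simp add: orth_def image_mono)
  show ?thesis
  proof (intro equalityI subsetI)
    fix y assume y: "y \<in> orth (f ` E) ((`) f ` W)"
    then have "y \<subseteq> f ` E" by (simp add: orth_def)
    then obtain x where "x \<subseteq> E" "y = f ` x" by (auto simp: subset_image_iff)
    then show "y \<in> (`) f ` orth E W" using y eq by simp
  next
    fix y assume "y \<in> (`) f ` orth E W"
    then obtain x where x: "x \<in> orth E W" "y = f ` x" by auto
    then have "x \<subseteq> E" by (simp add: orth_def)
    then show "y \<in> orth (f ` E) ((`) f ` W)" using x eq by simp
  qed
qed

text \<open>The fibre over a point of the image is a translate of the kernel. Dimensions are handled
  as cardinalities, and this takes the place of the rank-nullity theorem.\<close>

lemma card_preimage_additive:
  assumes "finite E" "subspace_of E A"
    and add: "\<And>x y. x \<in> A \<Longrightarrow> y \<in> A \<Longrightarrow> L (sym_diff x y) = sym_diff (L x) (L y)"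
    and T: "T \<subseteq> L ` A"
  shows "card {a \<in> A. L a \<in> T} = card T * card {a \<in> A. L a = {}}"
proof -
  have fA: "finite A" using assms by (auto intro: finite_subspace_of)
  have fT: "finite T" using T fA by (auto intro: finite_subset)
  have "card {a \<in> A. L a \<in> T} = card (\<Union>t\<in>T. {a \<in> A. L a = t})"
    by (rule arg_cong[of _ _ card]) auto
  also have "\<dots> = (\<Sum>t\<in>T. card {a \<in> A. L a = t})"
    using fA fT by (intro card_UN_disjoint) auto
  also have "\<dots> = (\<Sum>t\<in>T. card {a \<in> A. L a = {}})"
  proof (rule sum.cong)
    fix t assume "t \<in> T"
    then obtain b where b: "b \<in> A" "L b = t" using T by auto
    have "bij_betw (\<lambda>a. sym_diff a b) {a \<in> A. L a = t} {a \<in> A. L a = {}}"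
      using b subspace_ofD(3)[OF assms(2)] 
      by (intro bij_betw_byWitness[where f' = "\<lambda>a. sym_diff a b"]) (auto simp: add)
    then show "card {a \<in> A. L a = t} = card {a \<in> A. L a = {}}"
      by (rule bij_betw_same_card)
  qed simp
  finally show ?thesis by simp
qed

lemma card_image_additive:
  assumes "finite E" "subspace_of E A"
    and "\<And>x y. x \<in> A \<Longrightarrow> y \<in> A \<Longrightarrow> L (sym_diff x y) = sym_diff (L x) (L y)"
  shows "card A = card (L ` A) * card {a \<in> A. L a = {}}"
proof -
  have "{a \<in> A. L a \<in> L ` A} = A" by auto
  then show ?thesis using card_preimage_additive[OF assms subset_refl] by simp
qed

lemma subspace_of_image:
  assumes "subspace_of E A" "L ` A \<subseteq> Pow F"
    and add: "\<And>x y. x \<in> A \<Longrightarrow> y \<in> A \<Longrightarrow> L (sym_diff x y) = sym_diff (L x) (L y)"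
  shows "subspace_of F (L ` A)"
proof -
  have "L {} = {}"
    using add[of "{}" "{}"] subspace_ofD(2)[OF assms(1)] by auto
  then have "{} \<in> L ` A"
    using subspace_ofD(2)[OF assms(1)] by (metis image_eqI)
  moreover have "sym_diff (L x) (L y) \<in> L ` A" if "x \<in> A" "y \<in> A" for x y
    using add[OF that] subspace_ofD(3)[OF assms(1) that] by (metis image_eqI)
  ultimately show ?thesis using assms(2) by (simp add: subspace_of_def)
qed

text \<open>\<open>f\<close> permutes \<open>S\<close>, so as many elements of \<open>S\<close> lie
  in \<open>Z\<close> as are sent into \<open>Z\<close>, and the changes form the symmetric
  difference of these two sets. The permutation will be a turn at crossings, a step along faces, or
  a step along the decomposition curves.\<close>

lemma even_card_changes:
  assumes "finite S" "inj_on f S" "f ` S \<subseteq> S"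
  shows "even (card {d \<in> S. (d \<in> Z) \<noteq> (f d \<in> Z)})"
proof -
  have "f ` S = S" using assms by (intro endo_inj_surj)
  then have "f ` {d \<in> S. f d \<in> Z} = S \<inter> Z" by auto
  then have "card {d \<in> S. f d \<in> Z} = card (S \<inter> Z)"
    using assms(2) by (metis (no_types, lifting) card_image inj_on_subset mem_Collect_eq subsetI)
  moreover have "{d \<in> S. (d \<in> Z) \<noteq> (f d \<in> Z)} = sym_diff (S \<inter> Z) {d \<in> S. f d \<in> Z}" by auto
  ultimately show ?thesis
    using assms(1) by (simp add: even_card_sym_diff)
qed

section \<open>Labellings that are constant on classes\<close>

definition invariant :: "'a set \<Rightarrow> ('a \<Rightarrow> 'a \<Rightarrow> bool) \<Rightarrow> 'a set set" where
  "invariant S R = {X. X \<subseteq> S \<and> (\<forall>x\<in>S. \<forall>y\<in>S. R x y \<longrightarrow> (x \<in> X \<longleftrightarrow> y \<in> X))}"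

lemma invariant_subset: "X \<in> invariant S R \<Longrightarrow> X \<subseteq> S"
  by (simp add: invariant_def)

lemma invariantD: "X \<in> invariant S R \<Longrightarrow> x \<in> S \<Longrightarrow> y \<in> S \<Longrightarrow> R x y \<Longrightarrow> y \<in> X \<longleftrightarrow> x \<in> X"
  by (auto simp: invariant_def)

lemma subspace_of_invariant: "subspace_of S (invariant S R)"
proof -
  have "sym_diff X Y \<in> invariant S R" if "X \<in> invariant S R" "Y \<in> invariant S R" for X Y
  proof -
    have "sym_diff X Y \<subseteq> S" using that invariant_subset by blast
    moreover have "x \<in> sym_diff X Y \<longleftrightarrow> y \<in> sym_diff X Y" if "x \<in> S" "y \<in> S" "R x y" for x y
      using invariantD[OF \<open>X \<in> _\<close> that] invariantD[OF \<open>Y \<in> _\<close> that] by simp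
    ultimately show ?thesis by (simp add: invariant_def)
  qed
  moreover have "{} \<in> invariant S R" by (simp add: invariant_def)
  moreover have "invariant S R \<subseteq> Pow S" using invariant_subset by blast
  ultimately show ?thesis by (simp add: subspace_of_def)
qed

lemma self_in_class_of: "x \<in> class_of S R x"
  by (simp add: class_of_def)

lemma class_of_eq: "y \<in> class_of S R x \<Longrightarrow> class_of S R y = class_of S R x"
proof -
  let ?R = "equivclp (\<lambda>u v. u \<in> S \<and> v \<in> S \<and> R u v)"
  assume "y \<in> class_of S R x"
  then have xy: "?R x y" and yx: "?R y x" by (simp_all add: class_of_def equivclp_sym)
  have "?R y z \<longleftrightarrow> ?R x z" for z
    using equivclp_trans[OF xy] equivclp_trans[OF yx] by iprover
  then show ?thesis by (simp only: class_of_def)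
qed

lemma class_of_step:
  assumes "x \<in> S" "y \<in> S" "R x y"
  shows "class_of S R x = class_of S R y"
proof (rule class_of_eq[symmetric])
  show "y \<in> class_of S R x"
    unfolding class_of_def mem_Collect_eq by (rule r_into_equivclp) (use assms in simp)
qed

lemma class_of_invariant:
  assumes "y \<in> class_of S R x" "\<And>u v. u \<in> S \<Longrightarrow> v \<in> S \<Longrightarrow> R u v \<Longrightarrow> P u \<longleftrightarrow> P v"
  shows "P x \<longleftrightarrow> P y"
proof -
  have "equivclp (\<lambda>u v. u \<in> S \<and> v \<in> S \<and> R u v) x y"
    using assms(1) by (simp add: class_of_def)
  then show ?thesis
    by (induction rule: equivclp_induct) (use assms(2) in auto)
qed

lemma class_of_subset: "x \<in> S \<Longrightarrow> class_of S R x \<subseteq> S"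
  using class_of_invariant[of _ S R x "\<lambda>z. z \<in> S"] by auto

lemma Union_classes: "\<Union>(classes S R) = S"
  unfolding classes_def using class_of_subset[of _ S R] self_in_class_of[of _ S R] by blast

lemma classes_eqI: "C \<in> classes S R \<Longrightarrow> x \<in> C \<Longrightarrow> C = class_of S R x"
  unfolding classes_def by (metis class_of_eq imageE)

text \<open>A labelling constant along \<open>R\<close> is a union of classes, and the classes in it
  can be chosen freely.\<close>

lemma card_invariant:
  assumes "finite S"
  shows "card (invariant S R) = 2 ^ card (classes S R)"
proof -
  have "bij_betw Union (Pow (classes S R)) (invariant S R)"
  proof (rule bij_betw_byWitness[where f' = "\<lambda>X. class_of S R ` X"])
    show "\<forall>Q\<in>Pow (classes S R). class_of S R ` \<Union>Q = Q"
    proof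
      fix Q assume Q: "Q \<in> Pow (classes S R)"
      have "class_of S R x \<in> Q" if "C \<in> Q" "x \<in> C" for C x
        using that Q classes_eqI[of C S R x] by auto
      moreover have "C \<in> class_of S R ` \<Union>Q" if C: "C \<in> Q" for C
      proof -
        obtain x where "C = class_of S R x"
          using C Q by (auto simp: classes_def)
        moreover from this have "x \<in> C" by (simp add: self_in_class_of)
        ultimately show ?thesis using C by blast
      qed
      ultimately show "class_of S R ` \<Union>Q = Q" by auto
    qed
    show "\<forall>X\<in>invariant S R. \<Union> (class_of S R ` X) = X"
    proof
      fix X assume "X \<in> invariant S R"
      then have "class_of S R x \<subseteq> X" if "x \<in> X" for x
        using that class_of_invariant[of _ S R x "\<lambda>z. z \<in> X"] by (auto simp: invariant_def)
      then show "\<Union> (class_of S R ` X) = X"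
        using self_in_class_of[of _ S R] by auto
    qed
    show "Union ` Pow (classes S R) \<subseteq> invariant S R"
    proof (clarsimp simp: invariant_def, intro conjI ballI impI)
      fix Q assume Q: "Q \<subseteq> classes S R"
      then show "\<Union>Q \<subseteq> S" using Union_classes[of S R] by auto
      fix x y assume xy: "x \<in> S" "y \<in> S" "R x y"
      have "x \<in> C \<longleftrightarrow> y \<in> C" if "C \<in> Q" for C
        using classes_eqI[of C S R] Q that class_of_step[of x S y R, OF xy] self_in_class_of[of _ S R]
        by blast
      then show "(\<exists>C\<in>Q. x \<in> C) \<longleftrightarrow> (\<exists>C\<in>Q. y \<in> C)" by blast
    qed
    show "(`) (class_of S R) ` invariant S R \<subseteq> Pow (classes S R)"
      by (auto simp: invariant_def classes_def)
  qed
  then show ?thesis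
    using assms by (simp add: bij_betw_same_card[symmetric] card_Pow classes_def)
qed

text \<open>\<open>orbit f x\<close> starts at \<open>f x\<close>, whereas a class contains
  \<open>x\<close> and is symmetric. They agree because \<open>f\<close> permutes the finite set
  \<open>S\<close>, so that orbits return to their start and are closed under predecessors.\<close>

lemma orbit_eq_class_of:
  assumes "finite S" "inj_on f S" "f ` S \<subseteq> S" "x \<in> S"
  shows "orbit f x = class_of S (\<lambda>x y. y = f x) x"
proof
  have sub: "orbit f x \<subseteq> S"
  proof
    fix y assume "y \<in> orbit f x"
    then show "y \<in> S" by induction (use assms in auto)
  qed
  have img: "f ` orbit f x = orbit f x"
    using finite_subset[OF sub assms(1)] inj_on_subset[OF assms(2) sub]
    by (intro endo_inj_surj) (auto intro: orbit.step)
  have pred: "z \<in> orbit f x" if "z \<in> S" "f z \<in> orbit f x" for z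
  proof -
    have "f z \<in> f ` orbit f x" using that(2) img by simp
    then show ?thesis using that(1) sub assms(2) by (auto dest: inj_onD)
  qed
  let ?R = "\<lambda>x y. y = f x"
  have next_class: "class_of S ?R (f y) = class_of S ?R y" if "y \<in> S" for y
    using that assms(3) by (intro class_of_step[symmetric]) auto
  show "orbit f x \<subseteq> class_of S (\<lambda>x y. y = f x) x"
  proof
    fix y assume "y \<in> orbit f x"
    then show "y \<in> class_of S (\<lambda>x y. y = f x) x"
    proof induction
      case base
      show ?case
        using next_class[OF assms(4)] self_in_class_of by metis
    next
      case (step y)
      then have "y \<in> S" using sub by auto
      then show ?case
        using next_class class_of_eq[OF step.IH] self_in_class_of by metis
    qed
  qed
  show "class_of S (\<lambda>x y. y = f x) x \<subseteq> orbit f x"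
  proof
    fix y assume "y \<in> class_of S (\<lambda>x y. y = f x) x"
    then have "x \<in> orbit f x \<longleftrightarrow> y \<in> orbit f x"
      by (rule class_of_invariant) (auto intro: pred orbit.step)
    then show "y \<in> orbit f x" using pred[OF assms(4) orbit.base] by simp
  qed
qed

lemma orbits_eq_classes:
  assumes "finite S" "inj_on f S" "f ` S \<subseteq> S"
  shows "orbit f ` S = classes S (\<lambda>x y. y = f x)"
  using orbit_eq_class_of[OF assms] by (auto simp: classes_def)

text \<open>As \<open>g x\<close> contains \<open>x\<close> and stays in its block, different blocks
  have disjoint images. This makes crossings, edges and faces additive over components.\<close>

lemma card_image_partition:
  assumes "finite P" "\<And>C. C \<in> P \<Longrightarrow> finite C" "disjoint P"
    and "\<And>C x. C \<in> P \<Longrightarrow> x \<in> C \<Longrightarrow> x \<in> g x \<and> g x \<subseteq> C"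
  shows "card (g ` \<Union>P) = (\<Sum>C\<in>P. card (g ` C))"
proof -
  have "card (\<Union>C\<in>P. g ` C) = (\<Sum>C\<in>P. card (g ` C))"
  proof (rule card_UN_disjoint)
    show "\<forall>C\<in>P. \<forall>C'\<in>P. C \<noteq> C' \<longrightarrow> g ` C \<inter> g ` C' = {}"
    proof (intro ballI impI)
      fix C C' assume "C \<in> P" "C' \<in> P" "C \<noteq> C'"
      then have "C \<inter> C' = {}" using assms(3) by (auto simp: pairwise_def disjnt_def)
      then show "g ` C \<inter> g ` C' = {}"
        using assms(4)[OF \<open>C \<in> P\<close>] assms(4)[OF \<open>C' \<in> P\<close>] by fastforce
    qed
  qed (use assms in auto)
  then show ?thesis by (simp add: image_Union)
qed

section \<open>Labellings and cycles of a diagram\<close>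

text \<open>For a labelling of crossings this is a cut. For a labelling of faces it is the sum of
  face boundaries, because the faces on the two sides of an edge run along its two darts.\<close>

definition boundary :: "'d diagram \<Rightarrow> 'd set \<Rightarrow> 'd set set" where
  "boundary D X = {e \<in> dedges D. odd (card (X \<inter> e))}"

text \<open>
  A dart \<open>d\<close> also represents the corner clockwise of \<open>d\<close>, between \<open>d\<close> and its predecessor.  The face
  running along \<open>d\<close> passes through this corner, as does an A-curve if \<open>d\<close> is over and a B-curve
  otherwise.  So labellings of crossings, of faces and of state curves are all sets of darts and can
  be added.
\<close>

definition turns :: "'d diagram \<Rightarrow> 'd set \<Rightarrow> 'd set set" where
  "turns D Z = {e \<in> dedges D. \<exists>d\<in>e. (d \<in> Z) \<noteq> (rot D d \<in> Z)}"

text \<open>The corners \<open>d\<close> and \<open>rot D d\<close> lie on the two sides of the dart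
  \<open>d\<close>. Both ends of an edge must agree on whether the label changes across it, so that
  \<open>turns\<close> can be read off at either end.\<close>

definition turnable :: "'d diagram \<Rightarrow> 'd set \<Rightarrow> bool" where
  "turnable D Z \<longleftrightarrow> Z \<subseteq> darts D \<and> (\<forall>d\<in>darts D.
    ((d \<in> Z) \<noteq> (rot D d \<in> Z)) = ((mate D d \<in> Z) \<noteq> (rot D (mate D d) \<in> Z)))"

definition vertex_labels :: "'d diagram \<Rightarrow> 'd set set" where
  "vertex_labels D = invariant (darts D) (\<lambda>x y. y = rot D x)"

definition face_labels :: "'d diagram \<Rightarrow> 'd set set" where
  "face_labels D = invariant (darts D) (\<lambda>x y. y = face_step D x)"

definition component_labels :: "'d diagram \<Rightarrow> 'd set set" where
  "component_labels D = invariant (darts D) (\<lambda>x y. y = rot D x \<or> y = mate D x)"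

text \<open>State curves follow an alternating edge on one side, from the corner \<open>d\<close> to
  \<open>rot D (mate D d)\<close>, and change sides along a non-alternating edge. So these are the
  labels of corners that are constant along all A-curves and B-curves.\<close>

definition state_labels :: "'d diagram \<Rightarrow> 'd set set" where
  "state_labels D = {Z. Z \<subseteq> darts D \<and> (\<forall>d\<in>darts D.
    if d \<in> marked D then (d \<in> Z \<longleftrightarrow> mate D d \<in> Z) \<and> (rot D d \<in> Z \<longleftrightarrow> rot D (mate D d) \<in> Z)
    else (d \<in> Z \<longleftrightarrow> rot D (mate D d) \<in> Z))}"

definition cycles :: "'d diagram \<Rightarrow> 'd set set set" where
  "cycles D = orth (dedges D) (boundary D ` vertex_labels D)"

definition marked_cycles :: "'d diagram \<Rightarrow> 'd set set set" where
  "marked_cycles D = (\<lambda>x. x \<inter> nonalternating_edges D) ` cycles D"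

section \<open>Edges and boundaries in terms of darts\<close>

context link_diagram
begin

lemma finite_dedges: "finite (dedges D)"
  using finite_darts by (simp add: dedges_def)

lemma edge_in_dedges: "d \<in> darts D \<Longrightarrow> {d, mate D d} \<in> dedges D"
  by (simp add: dedges_def)

lemma dedges_cases:
  assumes "e \<in> dedges D"
  obtains d where "d \<in> darts D" "e = {d, mate D d}"
  using assms by (auto simp: dedges_def)

lemma dedges_eqI:
  assumes "x \<subseteq> dedges D" "y \<subseteq> dedges D"
    and "\<And>d. d \<in> darts D \<Longrightarrow> {d, mate D d} \<in> x \<longleftrightarrow> {d, mate D d} \<in> y"
  shows "x = y"
  using assms by (blast elim: dedges_cases)

lemma edge_eq:
  assumes "e \<in> dedges D" "d \<in> e"
  shows "d \<in> darts D" "e = {d, mate D d}"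
  using assms mate_closed mate_mate by (auto simp: dedges_def)

lemma Union_edges:
  assumes "y \<subseteq> dedges D"
  shows "\<Union>y = {d \<in> darts D. {d, mate D d} \<in> y}"
  using assms edge_eq by blast

lemma marked_closed: "d \<in> marked D \<Longrightarrow> d \<in> darts D \<and> mate D d \<in> marked D"
  by (auto simp: marked_def mate_closed mate_mate)

lemma marked_mate_iff: "d \<in> darts D \<Longrightarrow> mate D d \<in> marked D \<longleftrightarrow> d \<in> marked D"
  using marked_closed mate_mate by metis

lemma nonalternating_subset: "nonalternating_edges D \<subseteq> dedges D"
  using marked_closed by (auto simp: nonalternating_edges_def dedges_def)

lemma edge_in_nonalternating:
  assumes "d \<in> darts D"
  shows "{d, mate D d} \<in> nonalternating_edges D \<longleftrightarrow> d \<in> marked D"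
proof
  assume "{d, mate D d} \<in> nonalternating_edges D"
  then obtain p where p: "p \<in> marked D" "{d, mate D d} = {p, mate D p}"
    by (auto simp: nonalternating_edges_def)
  then have "d = p \<or> d = mate D p" by blast
  then show "d \<in> marked D" using p marked_closed by auto
qed (auto simp: nonalternating_edges_def)

lemma boundary_subset: "boundary D X \<subseteq> dedges D"
  by (auto simp: boundary_def)

lemma edge_in_boundary:
  assumes "d \<in> darts D"
  shows "{d, mate D d} \<in> boundary D X \<longleftrightarrow> (d \<in> X) \<noteq> (mate D d \<in> X)"
proof -
  have "mate D d \<noteq> d" using assms by (rule mate_neq)
  then have "odd (card (X \<inter> {d, mate D d})) \<longleftrightarrow> (d \<in> X) \<noteq> (mate D d \<in> X)"
    by (simp add: Int_insert_right)
  then show ?thesis using assms by (simp add: boundary_def edge_in_dedges)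
qed

lemma boundary_sym_diff: "boundary D (sym_diff X Y) = sym_diff (boundary D X) (boundary D Y)"
  by (rule dedges_eqI) (use boundary_subset in \<open>auto simp: edge_in_boundary\<close>)

text \<open>Edges are disjoint sets of darts, and modulo 2 only those with exactly one dart in
  \<open>X\<close> count. This turns dot products of edge sets into counts of darts, on which
  permutations act.\<close>

lemma even_card_boundary_Int:
  assumes "y \<subseteq> dedges D"
  shows "even (card (boundary D X \<inter> y)) \<longleftrightarrow> even (card (X \<inter> \<Union>y))"
proof -
  have fin: "finite y" using assms finite_dedges finite_subset by blast
  have "card (X \<inter> \<Union>y) = card (\<Union>e\<in>y. X \<inter> e)"
    by (rule arg_cong[of _ _ card]) auto
  also have "\<dots> = (\<Sum>e\<in>y. card (X \<inter> e))"
  proof (rule card_UN_disjoint[OF fin])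
    show "\<forall>e\<in>y. finite (X \<inter> e)"
      using assms by (auto simp: dedges_def)
    show "\<forall>e\<in>y. \<forall>e'\<in>y. e \<noteq> e' \<longrightarrow> X \<inter> e \<inter> (X \<inter> e') = {}"
      using assms edge_eq(2) by blast
  qed
  also have "even \<dots> \<longleftrightarrow> even (card {e \<in> y. odd (card (X \<inter> e))})"
    using fin by (rule even_sum_iff)
  also have "{e \<in> y. odd (card (X \<inter> e))} = boundary D X \<inter> y"
    using assms by (auto simp: boundary_def)
  finally show ?thesis by simp
qed

section \<open>Labels along rotations and faces, and the cycles they turn across\<close>

lemma rot_inj: "inj_on (rot D) (darts D)"
proof (rule inj_onI)
  fix x y assume "x \<in> darts D" "y \<in> darts D" "rot D x = rot D y"
  then have "(rot D ^^ 4) x = (rot D ^^ 4) y"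
    by (simp add: numeral_eq_Suc)
  then show "x = y" using rot_four \<open>x \<in> darts D\<close> \<open>y \<in> darts D\<close> by simp
qed

lemma mate_inj: "inj_on (mate D) (darts D)"
  using mate_mate by (metis inj_onI)

lemma face_step_closed: "d \<in> darts D \<Longrightarrow> face_step D d \<in> darts D"
  by (simp add: face_step_def mate_closed rot_closed)

lemma face_step_inj: "inj_on (face_step D) (darts D)"
  using comp_inj_on[OF mate_inj inj_on_subset[OF rot_inj]] mate_closed
  by (auto simp: face_step_def[abs_def] comp_def)

lemma face_step_mate: "d \<in> darts D \<Longrightarrow> face_step D (mate D d) = rot D d"
  by (simp add: face_step_def mate_mate)

lemma vertex_labelsD: "U \<in> vertex_labels D \<Longrightarrow> d \<in> darts D \<Longrightarrow> rot D d \<in> U \<longleftrightarrow> d \<in> U"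
  by (auto simp: vertex_labels_def invariant_def rot_closed)

lemma face_labelsD: "X \<in> face_labels D \<Longrightarrow> d \<in> darts D \<Longrightarrow> rot D (mate D d) \<in> X \<longleftrightarrow> d \<in> X"
  by (auto simp: face_labels_def invariant_def face_step_closed simp flip: face_step_def)

lemma face_labelsD': "X \<in> face_labels D \<Longrightarrow> d \<in> darts D \<Longrightarrow> rot D d \<in> X \<longleftrightarrow> mate D d \<in> X"
  using face_labelsD[of X "mate D d"] by (simp add: mate_closed mate_mate)

lemma labels_subset:
  "X \<in> vertex_labels D \<Longrightarrow> X \<subseteq> darts D"
  "X \<in> face_labels D \<Longrightarrow> X \<subseteq> darts D"
  "X \<in> state_labels D \<Longrightarrow> X \<subseteq> darts D"
  by (auto simp: vertex_labels_def face_labels_def state_labels_def invariant_def)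

lemma state_labelsD:
  assumes "Z \<in> state_labels D" "d \<in> darts D"
  shows "d \<in> marked D \<Longrightarrow> mate D d \<in> Z \<longleftrightarrow> d \<in> Z"
    and "d \<in> marked D \<Longrightarrow> rot D (mate D d) \<in> Z \<longleftrightarrow> rot D d \<in> Z"
    and "d \<notin> marked D \<Longrightarrow> rot D (mate D d) \<in> Z \<longleftrightarrow> d \<in> Z"
    and "d \<notin> marked D \<Longrightarrow> rot D d \<in> Z \<longleftrightarrow> mate D d \<in> Z"
proof -
  have *: "\<And>d. d \<in> darts D \<Longrightarrow>
    if d \<in> marked D then (d \<in> Z \<longleftrightarrow> mate D d \<in> Z) \<and> (rot D d \<in> Z \<longleftrightarrow> rot D (mate D d) \<in> Z)
    else (d \<in> Z \<longleftrightarrow> rot D (mate D d) \<in> Z)"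
    using assms(1) by (auto simp: state_labels_def)
  show "d \<in> marked D \<Longrightarrow> mate D d \<in> Z \<longleftrightarrow> d \<in> Z"
    "d \<in> marked D \<Longrightarrow> rot D (mate D d) \<in> Z \<longleftrightarrow> rot D d \<in> Z"
    "d \<notin> marked D \<Longrightarrow> rot D (mate D d) \<in> Z \<longleftrightarrow> d \<in> Z"
    using *[OF assms(2)] by simp_all
  show "d \<notin> marked D \<Longrightarrow> rot D d \<in> Z \<longleftrightarrow> mate D d \<in> Z"
    using *[OF mate_closed[OF assms(2)]] assms(2) by (simp add: marked_mate_iff mate_mate)
qed

lemma edge_in_turns:
  assumes "turnable D Z" "d \<in> darts D"
  shows "{d, mate D d} \<in> turns D Z \<longleftrightarrow> (d \<in> Z) \<noteq> (rot D d \<in> Z)"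
  using assms edge_in_dedges[OF assms(2)] by (auto simp: turns_def turnable_def)

lemma turns_subset: "turns D Z \<subseteq> dedges D"
  by (auto simp: turns_def)

text \<open>A cut comes from a set \<open>U\<close> of darts that is permuted by
  \<open>rot D\<close>, and membership in \<open>Z\<close> changes an even number of times under a
  permutation of \<open>U\<close>.\<close>

lemma turns_in_cycles:
  assumes "turnable D Z"
  shows "turns D Z \<in> cycles D"
proof -
  have "even (card (boundary D U \<inter> turns D Z))" if U: "U \<in> vertex_labels D" for U
  proof -
    have "U \<inter> \<Union>(turns D Z) = {d \<in> U. (d \<in> Z) \<noteq> (rot D d \<in> Z)}"
      using labels_subset(1)[OF U] edge_in_turns[OF assms]
      by (auto simp: Union_edges[OF turns_subset])
    moreover have "even (card {d \<in> U. (d \<in> Z) \<noteq> (rot D d \<in> Z)})"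
    proof (rule even_card_changes)
      show "finite U" using labels_subset(1)[OF U] finite_darts finite_subset by blast
      show "inj_on (rot D) U" using labels_subset(1)[OF U] rot_inj inj_on_subset by blast
      show "rot D ` U \<subseteq> U" using labels_subset(1)[OF U] vertex_labelsD[OF U] by blast
    qed
    ultimately show ?thesis by (simp add: even_card_boundary_Int turns_subset)
  qed
  then show ?thesis by (auto simp: cycles_def orth_def turns_subset)
qed

lemma turnable_face_labels: "X \<in> face_labels D \<Longrightarrow> turnable D X"
  using labels_subset(2) by (auto simp: turnable_def face_labelsD face_labelsD')

text \<open>The corner \<open>rot D d\<close> belongs to the face running along
  \<open>mate D d\<close>, so comparing the two corners at \<open>d\<close> compares the two sides
  of the edge.\<close>

lemma turns_face_labels: "X \<in> face_labels D \<Longrightarrow> turns D X = boundary D X"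
  by (rule dedges_eqI)
    (auto simp: turns_subset boundary_subset edge_in_turns edge_in_boundary turnable_face_labels
      face_labelsD')

lemma turnable_state_labels:
  assumes "Z \<in> state_labels D"
  shows "turnable D Z"
  unfolding turnable_def
proof (intro conjI ballI)
  show "Z \<subseteq> darts D" using assms by (rule labels_subset)
  fix d assume "d \<in> darts D"
  then show "((d \<in> Z) \<noteq> (rot D d \<in> Z)) = ((mate D d \<in> Z) \<noteq> (rot D (mate D d) \<in> Z))"
    using state_labelsD[OF assms \<open>d \<in> darts D\<close>] by blast
qed

section \<open>Components, valency and Euler's formula\<close>

lemma component_labels_iff:
  "X \<in> component_labels D \<longleftrightarrow>
    X \<in> vertex_labels D \<and> (\<forall>d\<in>darts D. mate D d \<in> X \<longleftrightarrow> d \<in> X)"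
proof
  assume X: "X \<in> component_labels D"
  then have "mate D d \<in> X \<longleftrightarrow> d \<in> X" if "d \<in> darts D" for d
    using that mate_closed[OF that] by (auto simp: component_labels_def invariant_def)
  then show "X \<in> vertex_labels D \<and> (\<forall>d\<in>darts D. mate D d \<in> X \<longleftrightarrow> d \<in> X)"
    using X by (auto simp: component_labels_def vertex_labels_def invariant_def)
qed (auto simp: component_labels_def vertex_labels_def invariant_def)

lemma finite_dart_components: "finite (dart_components D)"
  using finite_darts by (simp add: dart_components_def classes_def)

lemma Union_dart_components: "\<Union>(dart_components D) = darts D"
  by (simp add: dart_components_def Union_classes)

lemma disjoint_dart_components: "disjoint (dart_components D)"
proof -
  have "C = C'" if "C \<in> dart_components D" "C' \<in> dart_components D" "x \<in> C" "x \<in> C'" for C C' x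
    using classes_eqI[OF that(1)[unfolded dart_components_def] that(3)]
      classes_eqI[OF that(2)[unfolded dart_components_def] that(4)] by simp
  then show ?thesis by (auto simp: pairwise_def disjnt_iff)
qed

lemma dart_component_closed:
  assumes "C \<in> dart_components D" "d \<in> C"
  shows "d \<in> darts D" "rot D d \<in> C" "mate D d \<in> C"
proof -
  let ?R = "\<lambda>x y. y = rot D x \<or> y = mate D x"
  show d: "d \<in> darts D" using assms Union_dart_components by auto
  have C: "C = class_of (darts D) ?R d"
    using assms unfolding dart_components_def by (rule classes_eqI)
  show "rot D d \<in> C"
    using class_of_step[of d "darts D" "rot D d" ?R] d rot_closed[OF d]
      self_in_class_of[of "rot D d" "darts D" ?R] by (simp add: C)
  show "mate D d \<in> C"
    using class_of_step[of d "darts D" "mate D d" ?R] d mate_closed[OF d]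
      self_in_class_of[of "mate D d" "darts D" ?R] by (simp add: C)
qed

lemma card_dedges: "2 * card (dedges D) = card (darts D)"
proof -
  have "2 * card (dedges D) = card (\<Union>(dedges D))"
  proof (rule card_partition)
    show "finite (\<Union> (dedges D))" using finite_dedges by (auto simp: dedges_def)
    show "card e = 2" if "e \<in> dedges D" for e
      using that mate_neq by (auto simp: dedges_def card_2_iff)
    show "e \<inter> e' = {}" if "e \<in> dedges D" "e' \<in> dedges D" "e \<noteq> e'" for e e'
      using that edge_eq(2) by blast
  qed (rule finite_dedges)
  moreover have "\<Union>(dedges D) = darts D"
    using edge_eq(1) edge_in_dedges by blast
  ultimately show ?thesis by simp
qed

lemma orbit_rot:
  assumes "d \<in> darts D"
  shows "orbit (rot D) d = {d, rot D d, rot D (rot D d), rot D (rot D (rot D d))}"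
proof
  have *: "rot D (rot D (rot D (rot D d))) = d"
    using rot_four[OF assms] by (simp add: numeral_eq_Suc)
  show "orbit (rot D) d \<subseteq> {d, rot D d, rot D (rot D d), rot D (rot D (rot D d))}"
  proof
    fix y assume "y \<in> orbit (rot D) d"
    then show "y \<in> {d, rot D d, rot D (rot D d), rot D (rot D (rot D d))}"
      by induction (use * in auto)
  qed
  show "{d, rot D d, rot D (rot D d), rot D (rot D (rot D d))} \<subseteq> orbit (rot D) d"
  proof -
    have 1: "rot D d \<in> orbit (rot D) d" by (rule orbit.base)
    have 2: "rot D (rot D d) \<in> orbit (rot D) d" using 1 by (rule orbit.step)
    have 3: "rot D (rot D (rot D d)) \<in> orbit (rot D) d" using 2 by (rule orbit.step)
    have "rot D (rot D (rot D (rot D d))) \<in> orbit (rot D) d" using 3 by (rule orbit.step)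
    then show ?thesis using 1 2 3 by (simp add: *)
  qed
qed

lemma crossings_eq_classes: "crossings D = classes (darts D) (\<lambda>x y. y = rot D x)"
  unfolding crossings_def using finite_darts rot_inj
  by (rule orbits_eq_classes) (auto simp: rot_closed)

lemma faces_eq_classes: "faces D = classes (darts D) (\<lambda>x y. y = face_step D x)"
  unfolding faces_def using finite_darts face_step_inj
  by (rule orbits_eq_classes) (auto simp: face_step_closed)

text \<open>Among the four darts of an orbit, the alternation of over and under separates those an
  odd number of turns apart, and \<open>rot_two\<close> separates opposite ones.\<close>

lemma card_crossings: "4 * card (crossings D) = card (darts D)"
proof -
  have "4 * card (crossings D) = card (\<Union>(crossings D))"
  proof (rule card_partition)
    show "finite (\<Union> (crossings D))"
      using finite_darts by (simp add: crossings_eq_classes Union_classes)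
    show "finite (crossings D)"
      using finite_darts by (simp add: crossings_def)
    show "card c = 4" if c: "c \<in> crossings D" for c
    proof -
      obtain d where d: "d \<in> darts D" "c = orbit (rot D) d" using c by (auto simp: crossings_def)
      have "rot D d \<in> darts D" "rot D (rot D d) \<in> darts D" using d rot_closed by auto
      note o = over_rot[OF d(1)] over_rot[OF this(1)] over_rot[OF this(2)]
      have "d \<noteq> rot D (rot D d)" "rot D d \<noteq> rot D (rot D (rot D d))"
        using rot_two[OF d(1)] rot_two[OF \<open>rot D d \<in> darts D\<close>]
        by (simp_all add: numeral_eq_Suc eq_commute)
      moreover have "d \<noteq> rot D d" using o(1) by auto
      moreover have "rot D d \<noteq> rot D (rot D d)" using o(2) by auto
      moreover have "rot D (rot D d) \<noteq> rot D (rot D (rot D d))" using o(3) by auto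
      moreover have "d \<noteq> rot D (rot D (rot D d))" using o by auto
      ultimately show ?thesis
        using d orbit_rot[OF d(1)] by simp
    qed
    show "c \<inter> c' = {}" if "c \<in> crossings D" "c' \<in> crossings D" "c \<noteq> c'" for c c'
      using that classes_eqI[of c "darts D"] classes_eqI[of c' "darts D"]
      unfolding crossings_eq_classes by (metis disjoint_iff)
  qed
  then show ?thesis by (simp add: crossings_eq_classes Union_classes)
qed

lemma card_image_components:
  assumes "\<And>C x. C \<in> dart_components D \<Longrightarrow> x \<in> C \<Longrightarrow> x \<in> g x \<and> g x \<subseteq> C"
  shows "card (g ` darts D) = (\<Sum>C\<in>dart_components D. card (g ` C))"
  using card_image_partition[OF finite_dart_components _ disjoint_dart_components assms]
    finite_subset[OF _ finite_darts] Union_dart_components by (metis Union_upper)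

text \<open>Sphericity is given for each component; orbits and edges stay inside components, so the
  formulas can be added up.\<close>

lemma euler:
  "card (crossings D) + card (faces D) = card (dedges D) + 2 * card (dart_components D)"
proof -
  have orb: "x \<in> orbit f x \<and> orbit f x \<subseteq> C"
    if "inj_on f (darts D)" "\<And>d. d \<in> darts D \<Longrightarrow> f d \<in> darts D" "\<And>d. d \<in> C \<Longrightarrow> f d \<in> C"
      "C \<in> dart_components D" "x \<in> C" for f C x
  proof
    show "x \<in> orbit f x"
      using orbit_eq_class_of[of "darts D" f x] finite_darts that self_in_class_of
        dart_component_closed(1) by (metis image_subsetI)
    show "orbit f x \<subseteq> C"
    proof
      fix y assume "y \<in> orbit f x"
      then show "y \<in> C" by induction (use that in auto)
    qed
  qed
  have "card (crossings D) = (\<Sum>C\<in>dart_components D. card (crossings (component D (Inl C))))"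
    unfolding crossings_def using orb[OF rot_inj rot_closed] dart_component_closed
    by (simp add: card_image_components)
  moreover have "card (faces D) = (\<Sum>C\<in>dart_components D. card (faces (component D (Inl C))))"
    unfolding faces_def using orb[OF face_step_inj face_step_closed] dart_component_closed
    by (simp add: card_image_components face_step_def[abs_def])
  moreover have "card (dedges D) = (\<Sum>C\<in>dart_components D. card (dedges (component D (Inl C))))"
    unfolding dedges_def using dart_component_closed
    by (simp add: card_image_components)
  moreover have "(\<Sum>C\<in>dart_components D.
      int (card (crossings (component D (Inl C)))) - int (card (dedges (component D (Inl C))))
        + int (card (faces (component D (Inl C))))) = (\<Sum>C\<in>dart_components D. 2)"
    by (intro sum.cong refl spherical)
  ultimately have "int (card (crossings D)) - int (card (dedges D)) + int (card (faces D)) =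
      2 * int (card (dart_components D))"
    by (simp add: sum.distrib sum_subtractf)
  then show ?thesis by linarith
qed

section \<open>Dimensions of the cut space and the cycle space\<close>

lemma card_labels:
  "card (vertex_labels D) = 2 ^ card (crossings D)"
  "card (face_labels D) = 2 ^ card (faces D)"
  "card (component_labels D) = 2 ^ card (dart_components D)"
  by (simp_all add: vertex_labels_def face_labels_def component_labels_def finite_darts
      card_invariant crossings_eq_classes faces_eq_classes dart_components_def)

lemma subspace_of_labels:
  "subspace_of (darts D) (vertex_labels D)" "subspace_of (darts D) (face_labels D)"
  by (simp_all add: vertex_labels_def face_labels_def subspace_of_invariant)

lemma subspace_of_cuts: "subspace_of (dedges D) (boundary D ` vertex_labels D)"
  using subspace_of_labels(1)
  by (rule subspace_of_image) (use boundary_subset boundary_sym_diff in auto)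

lemma subspace_of_cycles: "subspace_of (dedges D) (cycles D)"
  unfolding cycles_def using finite_dedges by (rule subspace_of_orth)

lemma boundary_eq_empty: "boundary D X = {} \<longleftrightarrow> (\<forall>d\<in>darts D. mate D d \<in> X \<longleftrightarrow> d \<in> X)"
proof -
  have "boundary D X = {} \<longleftrightarrow> (\<forall>d\<in>darts D. {d, mate D d} \<notin> boundary D X)"
    using boundary_subset by (auto elim: dedges_cases)
  then show ?thesis by (auto simp: edge_in_boundary)
qed

text \<open>The kernel of \<open>boundary D\<close> on vertex labels consists of the labels constant
  on components.\<close>

lemma card_cuts:
  "card (boundary D ` vertex_labels D) * 2 ^ card (dart_components D) = 2 ^ card (crossings D)"
proof -
  have "{X \<in> vertex_labels D. boundary D X = {}} = component_labels D"
    by (auto simp: boundary_eq_empty component_labels_iff)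
  then show ?thesis
    using card_image_additive[OF finite_darts subspace_of_labels(1), of "boundary D"]
    by (simp add: card_labels boundary_sym_diff)
qed

text \<open>The kernel is again the component labels: once a label agrees on both darts of every
  edge, invariance under \<open>rot D\<close> and under \<open>face_step D\<close> are the
  same.\<close>

lemma card_face_boundaries:
  "card (boundary D ` face_labels D) * 2 ^ card (dart_components D) = 2 ^ card (faces D)"
proof -
  have "X \<in> component_labels D \<longleftrightarrow> X \<in> face_labels D \<and> (\<forall>d\<in>darts D. mate D d \<in> X \<longleftrightarrow> d \<in> X)" for X
    unfolding component_labels_iff
  proof (intro conj_cong iffI refl conjI; elim conjE)
    assume X: "\<forall>d\<in>darts D. mate D d \<in> X \<longleftrightarrow> d \<in> X"
    {
      assume "X \<in> vertex_labels D"
      then show "X \<in> face_labels D"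
        using vertex_labelsD[of X] X labels_subset(1)[of X] mate_closed
        by (auto simp: face_labels_def invariant_def face_step_def)
    }
    {
      assume "X \<in> face_labels D"
      then show "X \<in> vertex_labels D"
        using face_labelsD'[of X] X labels_subset(2)[of X]
        by (auto simp: vertex_labels_def invariant_def)
    }
  qed auto
  then have "{X \<in> face_labels D. boundary D X = {}} = component_labels D"
    by (auto simp: boundary_eq_empty)
  then show ?thesis
    using card_image_additive[OF finite_darts subspace_of_labels(2), of "boundary D"]
    by (simp add: card_labels boundary_sym_diff)
qed

text \<open>Sphericity enters here: by Euler's formula both sides have the same cardinality.\<close>

lemma cycles_eq_face_boundaries: "cycles D = boundary D ` face_labels D"
proof (rule card_subset_eq[symmetric])
  show "finite (cycles D)"
    using finite_dedges subspace_of_cycles by (rule finite_subspace_of)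
  show "boundary D ` face_labels D \<subseteq> cycles D"
    using turns_in_cycles turnable_face_labels turns_face_labels by fastforce
  let ?k = "card (dart_components D)" and ?V = "card (crossings D)" and ?E = "card (dedges D)"
  \<comment> \<open>As complement of the cuts, the cycle space has dimension E - V + k; Euler's
    formula turns this into F - k, the dimension of the face boundaries.\<close>
  have "card (cycles D) * 2 ^ ?V = card (cycles D) * (card (boundary D ` vertex_labels D) * 2 ^ ?k)"
    by (simp only: card_cuts)
  also have "\<dots> = 2 ^ ?E * 2 ^ ?k"
    using card_orth[OF finite_dedges subspace_of_cuts] by (simp add: cycles_def mult_ac)
  finally have "card (cycles D) * 2 ^ ?k * 2 ^ ?V = 2 ^ (?E + 2 * ?k)"
    by (simp add: power_add mult_ac power_mult power2_eq_square)
  also have "\<dots> = 2 ^ card (faces D) * 2 ^ ?V"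
    by (simp add: power_add[symmetric] euler[symmetric] add.commute)
  finally have "card (cycles D) * 2 ^ ?k = 2 ^ card (faces D)"
    by simp
  then show "card (boundary D ` face_labels D) = card (cycles D)"
    using card_face_boundaries by (metis mult_right_cancel power_not_zero zero_neq_numeral)
qed

lemma card_cycles:
  "card (cycles D) * 2 ^ card (dart_components D) = 2 ^ (card (crossings D) + 2 * card (dart_components D))"
proof -
  \<comment> \<open>Every crossing has four darts and every edge two, so E = 2V.\<close>
  have "card (faces D) = card (crossings D) + 2 * card (dart_components D)"
    using euler card_dedges card_crossings by linarith
  then show ?thesis using card_face_boundaries by (simp add: cycles_eq_face_boundaries)
qed

end

section \<open>State curves and non-alternating edges\<close>

text \<open>A labelling of the decomposition curves of all components at once. Its boundary is to
  become a cut of the alternating decomposition graph.\<close>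

definition curve_labels :: "'d diagram \<Rightarrow> 'd set set" where
  "curve_labels D = {Y. Y \<subseteq> marked D \<and> (\<forall>p q. joined D p q \<longrightarrow> (p \<in> Y \<longleftrightarrow> q \<in> Y))}"

text \<open>The only candidate for \<open>q\<close> in \<open>joined D p q\<close>, made into a
  function so that the parity argument for permutations applies to it.\<close>

definition next_marked :: "'d diagram \<Rightarrow> 'd \<Rightarrow> 'd" where
  "next_marked D p =
    (face_step D ^^ (LEAST n. (face_step D ^^ n) (rot D p) \<in> marked D)) (rot D p)"

section \<open>Labellings of state curves\<close>

context link_diagram
begin

lemma subspace_of_state_labels: "subspace_of (darts D) (state_labels D)"
  unfolding subspace_of_def
proof (intro conjI ballI)
  show "state_labels D \<subseteq> Pow (darts D)" using labels_subset(3) by auto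
  show "{} \<in> state_labels D" by (simp add: state_labels_def)
  fix x y assume "x \<in> state_labels D" "y \<in> state_labels D"
  then show "sym_diff x y \<in> state_labels D"
    unfolding state_labels_def by (auto split: if_splits)
qed

lemma turns_sym_diff:
  assumes "Z \<in> state_labels D" "Z' \<in> state_labels D"
  shows "turns D (sym_diff Z Z') = sym_diff (turns D Z) (turns D Z')"
proof (rule dedges_eqI)
  have "sym_diff Z Z' \<in> state_labels D"
    using subspace_of_state_labels assms by (rule subspace_ofD)
  then show "{d, mate D d} \<in> turns D (sym_diff Z Z') \<longleftrightarrow>
      {d, mate D d} \<in> sym_diff (turns D Z) (turns D Z')" if "d \<in> darts D" for d
    using that assms by (auto simp: edge_in_turns turnable_state_labels)
qed (use turns_subset in auto)

text \<open>\<open>turns D Z\<close> is the sum of the state curves selected by \<open>Z\<close>. If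
  it vanishes, \<open>Z\<close> is constant around each crossing, and the conditions on state labels
  then carry it along edges; so the kernel is the component labels.\<close>

lemma card_state_curves:
  "card (turns D ` state_labels D) * 2 ^ card (dart_components D) = card (state_labels D)"
proof -
  have "Z \<in> state_labels D \<and> turns D Z = {} \<longleftrightarrow> Z \<in> component_labels D" for Z
  proof
    assume Z: "Z \<in> state_labels D \<and> turns D Z = {}"
    then have rot: "rot D d \<in> Z \<longleftrightarrow> d \<in> Z" if "d \<in> darts D" for d
      using edge_in_turns[OF turnable_state_labels that] by auto
    then have "mate D d \<in> Z \<longleftrightarrow> d \<in> Z" if "d \<in> darts D" for d
      using state_labelsD[of Z d] Z that by blast
    with rot show "Z \<in> component_labels D"
      using Z labels_subset(3) by (auto simp: component_labels_iff vertex_labels_def invariant_def)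
  next
    assume Z: "Z \<in> component_labels D"
    then have rot: "rot D d \<in> Z \<longleftrightarrow> d \<in> Z" and mate: "mate D d \<in> Z \<longleftrightarrow> d \<in> Z"
      if "d \<in> darts D" for d
      using that by (auto simp: component_labels_iff vertex_labelsD)
    moreover have "Z \<subseteq> darts D" using Z labels_subset(1) by (simp add: component_labels_iff)
    ultimately have "Z \<in> state_labels D"
      by (simp add: state_labels_def mate_closed)
    then show "Z \<in> state_labels D \<and> turns D Z = {}"
      using rot edge_in_turns[OF turnable_state_labels] turns_subset[of Z]
      by (blast elim: dedges_cases)
  qed
  then have "{Z \<in> state_labels D. turns D Z = {}} = component_labels D" by blast
  then show ?thesis
    using card_image_additive[OF finite_darts subspace_of_state_labels, of "turns D"]
    by (simp add: card_labels turns_sym_diff)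
qed

lemma card_state_labels:
  "card (state_labels D) = 2 ^ (card (A_state D) + card (B_state D))"
proof -
  let ?A = "invariant (darts D) (\<lambda>x y. y = mate D x \<or> (\<not> over D x \<and> y = rot D x))"
  let ?B = "invariant (darts D) (\<lambda>x y. y = mate D x \<or> (over D x \<and> y = rot D x))"
  \<comment> \<open>These maps pass between labels of darts and labels of corners. The A-curve
    through the dart \<open>d\<close> enters the corner \<open>d\<close> if \<open>d\<close> is over
    and the corner \<open>rot D d\<close> if it is under; the B-curve enters the other one.\<close>
  let ?f = "\<lambda>(X, Y). {d \<in> darts D. if over D d then d \<in> X else d \<in> Y}"
  let ?g = "\<lambda>Z. ({d \<in> darts D. (if over D d then d else rot D d) \<in> Z},
                  {d \<in> darts D. (if over D d then rot D d else d) \<in> Z})"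
  have A: "X \<subseteq> darts D" "\<And>d. d \<in> darts D \<Longrightarrow> mate D d \<in> X \<longleftrightarrow> d \<in> X"
    "\<And>d. d \<in> darts D \<Longrightarrow> \<not> over D d \<Longrightarrow> rot D d \<in> X \<longleftrightarrow> d \<in> X" if "X \<in> ?A" for X
    using that invariantD[OF that] invariant_subset[OF that] mate_closed rot_closed by blast+
  have B: "X \<subseteq> darts D" "\<And>d. d \<in> darts D \<Longrightarrow> mate D d \<in> X \<longleftrightarrow> d \<in> X"
    "\<And>d. d \<in> darts D \<Longrightarrow> over D d \<Longrightarrow> rot D d \<in> X \<longleftrightarrow> d \<in> X" if "X \<in> ?B" for X
    using that invariantD[OF that] invariant_subset[OF that] mate_closed rot_closed by blast+
  have "bij_betw ?f (?A \<times> ?B) (state_labels D)"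
  proof (rule bij_betw_byWitness[where f' = ?g])
    show "\<forall>p\<in>?A \<times> ?B. ?g (?f p) = p"
    proof
      fix p assume "p \<in> ?A \<times> ?B"
      then obtain X Y where p: "p = (X, Y)" "X \<in> ?A" "Y \<in> ?B" by auto
      show "?g (?f p) = p"
        using A[OF p(2)] B[OF p(3)] by (auto simp: p(1) over_rot rot_closed)
    qed
    show "\<forall>Z\<in>state_labels D. ?f (?g Z) = Z"
      using labels_subset(3) by (auto split: if_splits)
    show "?f ` (?A \<times> ?B) \<subseteq> state_labels D"
    proof (rule image_subsetI)
      fix p assume "p \<in> ?A \<times> ?B"
      then obtain X Y where p: "p = (X, Y)" "X \<in> ?A" "Y \<in> ?B" by auto
      show "?f p \<in> state_labels D"
        using A[OF p(2)] B[OF p(3)]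
        by (auto simp: p(1) state_labels_def marked_def over_rot rot_closed mate_closed)
    qed
    show "?g ` state_labels D \<subseteq> ?A \<times> ?B"
    proof (rule image_subsetI)
      fix Z assume Z: "Z \<in> state_labels D"
      have *: "over D (mate D d) \<longleftrightarrow> (if d \<in> marked D then over D d else \<not> over D d)"
        if "d \<in> darts D" for d using that by (auto simp: marked_def)
      have "(if over D (mate D d) then mate D d else rot D (mate D d)) \<in> Z \<longleftrightarrow>
          (if over D d then d else rot D d) \<in> Z"
        "(if over D (mate D d) then rot D (mate D d) else mate D d) \<in> Z \<longleftrightarrow>
          (if over D d then rot D d else d) \<in> Z" if "d \<in> darts D" for d
        using state_labelsD[OF Z that] *[OF that] by (auto split: if_splits)
      then show "?g Z \<in> ?A \<times> ?B"
        by (auto simp: invariant_def over_rot rot_closed mate_closed)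
    qed
  qed
  then have "card (state_labels D) = card ?A * card ?B"
    by (simp add: bij_betw_same_card[symmetric] card_cartesian_product)
  then show ?thesis
    by (simp add: card_invariant finite_darts power_add A_state_def B_state_def)
qed

section \<open>The span of the state curves as the radical\<close>

text \<open>Cycles are boundaries of face labels \<open>X\<close>, and \<open>face_step D\<close>
  permutes \<open>X\<close>. A step along an alternating edge keeps the state label; along a
  non-alternating edge it changes exactly where \<open>Z\<close> turns. So the dot product counts
  changes under a permutation.\<close>

lemma turns_orth_marked_cycles:
  assumes Z: "Z \<in> state_labels D"
  shows "turns D Z \<inter> nonalternating_edges D \<in>
    orth (nonalternating_edges D) (marked_cycles D)"
proof -
  let ?N = "nonalternating_edges D"
  have "even (card (boundary D X \<inter> (turns D Z \<inter> ?N)))" if X: "X \<in> face_labels D" for X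
  proof -
    have "d \<in> \<Union>(turns D Z \<inter> ?N) \<longleftrightarrow> (d \<in> Z) \<noteq> (face_step D d \<in> Z)" if "d \<in> X" for d
    proof -
      have d: "d \<in> darts D" using that X labels_subset(2) by blast
      then have "d \<in> \<Union>(turns D Z \<inter> ?N) \<longleftrightarrow> (d \<in> Z) \<noteq> (rot D d \<in> Z) \<and> d \<in> marked D"
        using turns_subset[of Z] nonalternating_subset
        by (subst Union_edges)
          (auto simp: edge_in_turns turnable_state_labels Z edge_in_nonalternating)
      then show ?thesis
        using state_labelsD[OF Z d] by (auto simp: face_step_def)
    qed
    then have "X \<inter> \<Union>(turns D Z \<inter> ?N) = {d \<in> X. (d \<in> Z) \<noteq> (face_step D d \<in> Z)}"
      by blast
    moreover have "even (card {d \<in> X. (d \<in> Z) \<noteq> (face_step D d \<in> Z)})"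
    proof (rule even_card_changes)
      show "finite X" using labels_subset(2)[OF X] finite_darts finite_subset by blast
      show "inj_on (face_step D) X"
        using labels_subset(2)[OF X] face_step_inj inj_on_subset by blast
      show "face_step D ` X \<subseteq> X"
        using labels_subset(2)[OF X] face_labelsD[OF X] by (auto simp: face_step_def)
    qed
    ultimately show ?thesis
      using turns_subset by (subst even_card_boundary_Int) auto
  qed
  then have "even (card (y \<inter> ?N \<inter> (turns D Z \<inter> ?N)))" if "y \<in> cycles D" for y
    using that by (auto simp: cycles_eq_face_boundaries Int_ac)
  then show ?thesis by (auto simp: orth_def marked_cycles_def)
qed

text \<open>A set of non-alternating edges meets a cycle only in its non-alternating part, so
  \<open>z\<close> is orthogonal to all cycles and lies in the double complement of the
  cuts.\<close>

lemma orth_marked_cycles_cut: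
  assumes "z \<in> orth (nonalternating_edges D) (marked_cycles D)"
  obtains U where "U \<in> vertex_labels D" "z = boundary D U" "z \<subseteq> nonalternating_edges D"
proof -
  let ?N = "nonalternating_edges D"
  have z: "z \<subseteq> ?N" using assms by (simp add: orth_def)
  have "even (card (y \<inter> z))" if "y \<in> cycles D" for y
  proof -
    have "even (card (y \<inter> ?N \<inter> z))"
      using assms that by (auto simp: orth_def marked_cycles_def)
    moreover have "y \<inter> ?N \<inter> z = y \<inter> z" using z by auto
    ultimately show ?thesis by simp
  qed
  then have "z \<in> orth (dedges D) (cycles D)"
    using z nonalternating_subset by (auto simp: orth_def)
  then have "z \<in> boundary D ` vertex_labels D"
    by (simp add: cycles_def orth_orth finite_dedges subspace_of_cuts)
  then show ?thesis using that z by auto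
qed

text \<open>
  If \<open>x\<close> is the boundary of the face labelling \<open>X\<close> and its non-alternating part is the cut given by
  the vertex labelling \<open>U\<close>, then \<open>X + U\<close> is constant along state curves.
\<close>

lemma turns_state_labels:
  "turns D ` state_labels D = {x \<in> cycles D. x \<inter> nonalternating_edges D \<in>
    marked_cycles D \<inter> orth (nonalternating_edges D) (marked_cycles D)}"
proof (intro equalityI subsetI)
  fix x assume "x \<in> turns D ` state_labels D"
  then show "x \<in> {x \<in> cycles D. x \<inter> nonalternating_edges D \<in>
      marked_cycles D \<inter> orth (nonalternating_edges D) (marked_cycles D)}"
    using turns_orth_marked_cycles turns_in_cycles turnable_state_labels
    by (auto simp: marked_cycles_def)
next
  let ?N = "nonalternating_edges D"
  fix x assume "x \<in> {x \<in> cycles D. x \<inter> ?N \<in> marked_cycles D \<inter> orth ?N (marked_cycles D)}"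
  then have "x \<in> cycles D" and "x \<inter> ?N \<in> orth ?N (marked_cycles D)" by auto
  then obtain X U where X: "X \<in> face_labels D" "x = boundary D X"
    and U: "U \<in> vertex_labels D" "x \<inter> ?N = boundary D U"
    by (metis cycles_eq_face_boundaries imageE orth_marked_cycles_cut)
  let ?Z = "sym_diff X U"
  have sub: "?Z \<subseteq> darts D" using X U labels_subset by auto
  have in_U: "(d \<in> U) \<noteq> (mate D d \<in> U) \<longleftrightarrow> d \<in> marked D \<and> (d \<in> X) \<noteq> (mate D d \<in> X)"
    if "d \<in> darts D" for d
  proof -
    have "{d, mate D d} \<in> boundary D U \<longleftrightarrow> {d, mate D d} \<in> boundary D X \<inter> ?N"
      using U(2) X(2) by simp
    then show ?thesis
      using that by (simp add: edge_in_boundary edge_in_nonalternating) blast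
  qed
  have "?Z \<in> state_labels D"
    unfolding state_labels_def
  proof (intro CollectI conjI ballI sub)
    \<comment> \<open>Between the two darts of an alternating edge \<open>U\<close> does not change,
      and \<open>X\<close> is constant along the face; on a non-alternating edge \<open>X\<close>
      and \<open>U\<close> change together, so their sum agrees on both darts.\<close>
    fix d assume d: "d \<in> darts D"
    show "if d \<in> marked D then (d \<in> ?Z \<longleftrightarrow> mate D d \<in> ?Z) \<and> (rot D d \<in> ?Z \<longleftrightarrow> rot D (mate D d) \<in> ?Z)
      else (d \<in> ?Z \<longleftrightarrow> rot D (mate D d) \<in> ?Z)"
      using in_U[OF d] face_labelsD[OF X(1) d] face_labelsD'[OF X(1) d] vertex_labelsD[OF U(1) d]
        vertex_labelsD[OF U(1) mate_closed[OF d]] by auto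
  qed
  \<comment> \<open>\<open>U\<close> is constant around crossings, so adding it leaves the turns of
    \<open>X\<close> unchanged.\<close>
  moreover have "turns D ?Z = x"
  proof (rule dedges_eqI)
    fix d assume d: "d \<in> darts D"
    show "{d, mate D d} \<in> turns D ?Z \<longleftrightarrow> {d, mate D d} \<in> x"
      using d vertex_labelsD[OF U(1) d] face_labelsD'[OF X(1) d]
      by (auto simp: edge_in_turns turnable_state_labels calculation X(2) edge_in_boundary)
  qed (auto simp: turns_subset X(2) boundary_subset)
  ultimately show "x \<in> turns D ` state_labels D" by blast
qed

text \<open>Restriction to the non-alternating edges maps the cycles onto
  \<open>marked_cycles D\<close>, and by \<open>turns_state_labels\<close> the span of the state
  curves is the full preimage of the radical. Both fibre counts contain the same kernel, so the
  codimension of the span equals that of the radical.\<close>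

lemma card_marked_cycles:
  "2 ^ (card (A_state D) + card (B_state D)) * card (marked_cycles D) =
    card (marked_cycles D \<inter> orth (nonalternating_edges D) (marked_cycles D)) *
    2 ^ (card (crossings D) + 2 * card (dart_components D))"
proof -
  let ?res = "\<lambda>x. x \<inter> nonalternating_edges D"
  let ?ker = "card {x \<in> cycles D. ?res x = {}}"
  let ?rad = "marked_cycles D \<inter> orth (nonalternating_edges D) (marked_cycles D)"
  have c: "card (cycles D) = card (marked_cycles D) * ?ker"
    using card_image_additive[OF finite_dedges subspace_of_cycles, of ?res]
    by (simp add: sym_diff_Int marked_cycles_def)
  have s: "card (turns D ` state_labels D) = card ?rad * ?ker"
    unfolding turns_state_labels
    using finite_dedges subspace_of_cycles sym_diff_Int
    by (rule card_preimage_additive) (auto simp: marked_cycles_def)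
  have "2 ^ (card (A_state D) + card (B_state D)) * card (marked_cycles D) =
      card ?rad * (card (cycles D) * 2 ^ card (dart_components D))"
    using card_state_curves by (simp add: card_state_labels[symmetric] c s mult_ac)
  then show ?thesis by (simp only: card_cycles)
qed

section \<open>Marked points along faces and the cuts given by decomposition curves\<close>

lemma face_step_power_closed: "d \<in> darts D \<Longrightarrow> (face_step D ^^ n) d \<in> darts D"
  by (induction n) (auto simp: face_step_closed)

text \<open>The dart before \<open>rot D p\<close> on its face is \<open>mate D p\<close>, which is
  marked, and the walk along the face returns to it.\<close>

lemma next_marked_exists:
  assumes "p \<in> marked D"
  shows "\<exists>n. (face_step D ^^ n) (rot D p) \<in> marked D"
proof -
  have p: "p \<in> darts D" "mate D p \<in> marked D" "mate D p \<in> darts D"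
    using assms marked_closed by blast+
  have "mate D p \<in> orbit (face_step D) (mate D p)"
    using orbit_eq_class_of[OF finite_darts face_step_inj _ p(3)] face_step_closed
      self_in_class_of[of "mate D p"] by auto
  then obtain n where n: "mate D p = (face_step D ^^ n) (mate D p)" "n > 0"
    by (auto simp: orbit_altdef)
  then obtain m where "n = Suc m" using gr0_conv_Suc by blast
  then have "mate D p = (face_step D ^^ m) (rot D p)"
    using n(1) by (simp add: funpow_swap1 face_step_mate p(1))
  then show ?thesis using p(2) by metis
qed

lemma next_marked:
  assumes "p \<in> marked D"
  obtains n where "next_marked D p = (face_step D ^^ n) (rot D p)"
    "next_marked D p \<in> marked D" "\<And>m. m < n \<Longrightarrow> (face_step D ^^ m) (rot D p) \<notin> marked D"
proof
  show "next_marked D p = (face_step D ^^ (LEAST n. (face_step D ^^ n) (rot D p) \<in> marked D)) (rot D p)"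
    by (simp add: next_marked_def)
  show "next_marked D p \<in> marked D"
    unfolding next_marked_def using next_marked_exists[OF assms] by (rule LeastI_ex)
qed (rule not_less_Least)

text \<open>Undoing the common steps of two walks with the same end puts \<open>rot D p\<close> on
  the walk from \<open>rot D q\<close>. Unless it is the start, the dart before it is
  \<open>mate D p\<close>, a marked dart met too early.\<close>

lemma inj_on_next_marked: "inj_on (next_marked D) (marked D)"
proof -
  have "p = q"
    if p: "p \<in> marked D" and q: "q \<in> marked D" and "n \<le> m"
      and eq: "(face_step D ^^ n) (rot D p) = (face_step D ^^ m) (rot D q)"
      and min: "\<And>k. k < m \<Longrightarrow> (face_step D ^^ k) (rot D q) \<notin> marked D" for p q n m
  proof -
    have d: "p \<in> darts D" "q \<in> darts D" "mate D p \<in> darts D"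
      using p q marked_closed mate_closed by blast+
    define k where "k = m - n"
    have inj: "inj_on (face_step D ^^ n) (darts D)"
    proof (induction n)
      case (Suc n)
      have "(face_step D ^^ n) ` darts D \<subseteq> darts D" using face_step_power_closed by auto
      then show ?case
        using comp_inj_on[OF Suc inj_on_subset[OF face_step_inj]] by (simp add: comp_def)
    qed simp
    have "(face_step D ^^ n) (rot D p) = (face_step D ^^ n) ((face_step D ^^ k) (rot D q))"
      using eq \<open>n \<le> m\<close> by (simp add: k_def funpow_add[THEN fun_cong, simplified, symmetric])
    then have r: "rot D p = (face_step D ^^ k) (rot D q)"
      using inj_onD[OF inj] d rot_closed face_step_power_closed by simp
    show "p = q"
    proof (cases k)
      case 0
      then show ?thesis using r rot_inj d by (auto dest: inj_onD)
    next
      case (Suc j)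
      then have "face_step D (mate D p) = face_step D ((face_step D ^^ j) (rot D q))"
        using r d by (simp add: face_step_mate)
      then have "mate D p = (face_step D ^^ j) (rot D q)"
        using inj_onD[OF face_step_inj] d rot_closed face_step_power_closed by simp
      moreover have "j < m" using Suc by (simp add: k_def)
      ultimately show ?thesis
        using min[of j] p marked_closed by metis
    qed
  qed
  note * = this
  show ?thesis
  proof (rule inj_onI)
    fix p q assume pq: "p \<in> marked D" "q \<in> marked D" "next_marked D p = next_marked D q"
    obtain n where n: "next_marked D p = (face_step D ^^ n) (rot D p)"
      "\<And>m. m < n \<Longrightarrow> (face_step D ^^ m) (rot D p) \<notin> marked D"
      using next_marked[OF pq(1)] by metis
    obtain m where m: "next_marked D q = (face_step D ^^ m) (rot D q)"
      "\<And>k. k < m \<Longrightarrow> (face_step D ^^ k) (rot D q) \<notin> marked D"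
      using next_marked[OF pq(2)] by metis
    show "p = q"
    proof (cases "n \<le> m")
      case True
      with pq(1,2) show ?thesis by (rule *) (use n m pq(3) in auto)
    next
      case False
      then have "m \<le> n" by simp
      with pq(2,1) have "q = p" by (rule *) (use n m pq(3) in auto)
      then show ?thesis ..
    qed
  qed
qed

text \<open>
  Along a face the darts change between over and under exactly at the non-alternating edges.  So the
  next marked point never lies on the same edge, and the condition \<open>q \<notin> {p, mate D p}\<close> in
  \<^const>\<open>joined\<close> excludes nothing.
\<close>

lemma joined_next_marked:
  assumes "p \<in> marked D"
  shows "joined D p (next_marked D p)"
proof -
  obtain n where n: "next_marked D p = (face_step D ^^ n) (rot D p)"
    "next_marked D p \<in> marked D" "\<And>m. m < n \<Longrightarrow> (face_step D ^^ m) (rot D p) \<notin> marked D"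
    using next_marked[OF assms] by metis
  have p: "p \<in> darts D" using assms marked_closed by blast
  have "over D ((face_step D ^^ m) (rot D p)) \<longleftrightarrow> \<not> over D p" if "m \<le> n" for m
    using that
  proof (induction m)
    case 0
    then show ?case using p by (simp add: over_rot)
  next
    case (Suc m)
    let ?d = "(face_step D ^^ m) (rot D p)"
    have "?d \<in> darts D" using p by (simp add: face_step_power_closed rot_closed)
    moreover have "?d \<notin> marked D" using n(3) Suc.prems by simp
    ultimately have "over D (face_step D ?d) \<longleftrightarrow> over D ?d"
      by (auto simp: face_step_def marked_def over_rot mate_closed)
    then show ?case using Suc by simp
  qed
  then have "over D (next_marked D p) \<longleftrightarrow> \<not> over D p" using n(1) by simp
  moreover have "over D (mate D p) \<longleftrightarrow> over D p" using assms by (auto simp: marked_def)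
  ultimately have "next_marked D p \<notin> {p, mate D p}" by auto
  then show ?thesis using assms n by (auto simp: joined_def)
qed

text \<open>The walk from \<open>p\<close> to its successor stays in the face of
  \<open>mate D p\<close>. So the edge of \<open>p\<close> lies in the boundary of \<open>X\<close>
  iff membership in \<open>X\<close> changes from \<open>p\<close> to
  \<open>next_marked D p\<close>, and \<open>next_marked D\<close> permutes
  \<open>Y\<close>.\<close>

lemma marked_cycle_orth_curve_cut:
  assumes y: "y \<in> cycles D" and Y: "Y \<in> curve_labels D"
  shows "even (card (boundary D Y \<inter> (y \<inter> nonalternating_edges D)))"
proof -
  let ?N = "nonalternating_edges D"
  obtain X where X: "X \<in> face_labels D" "y = boundary D X"
    using y by (auto simp: cycles_eq_face_boundaries)
  have sub: "Y \<subseteq> marked D" using Y by (simp add: curve_labels_def)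
  have next_X: "next_marked D p \<in> X \<longleftrightarrow> mate D p \<in> X" if p: "p \<in> marked D" for p
  proof -
    have d: "p \<in> darts D" using p marked_closed by blast
    have "(face_step D ^^ m) (rot D p) \<in> X \<longleftrightarrow> mate D p \<in> X" for m
      by (induction m) (auto simp: face_labelsD[OF X(1)] face_labelsD'[OF X(1)] d rot_closed
          face_step_power_closed face_step_def[of D "(face_step D ^^ _) _"])
    then show ?thesis using next_marked[OF p] by metis
  qed
  have "p \<in> \<Union>(y \<inter> ?N) \<longleftrightarrow> (p \<in> X) \<noteq> (next_marked D p \<in> X)" if "p \<in> Y" for p
  proof -
    have "p \<in> marked D" "p \<in> darts D" using that sub marked_closed by blast+
    then show ?thesis
      using boundary_subset[of X] nonalternating_subset
      by (subst Union_edges) (auto simp: X(2) next_X edge_in_boundary edge_in_nonalternating)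
  qed
  then have "Y \<inter> \<Union>(y \<inter> ?N) = {p \<in> Y. (p \<in> X) \<noteq> (next_marked D p \<in> X)}" by blast
  moreover have "even (card {p \<in> Y. (p \<in> X) \<noteq> (next_marked D p \<in> X)})"
  proof (rule even_card_changes)
    show "finite Y" using sub marked_closed finite_darts by (meson finite_subset subset_eq)
    show "inj_on (next_marked D) Y" using sub inj_on_next_marked inj_on_subset by blast
    show "next_marked D ` Y \<subseteq> Y"
      using Y sub joined_next_marked by (auto simp: curve_labels_def)
  qed
  moreover have "y \<inter> ?N \<subseteq> dedges D" using nonalternating_subset by auto
  ultimately show ?thesis by (simp add: even_card_boundary_Int)
qed

text \<open>Such a \<open>U\<close> is constant around crossings and along alternating edges, hence
  along the walk between joined marked points; restricted to marked darts it labels curves and has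
  the same boundary.\<close>

lemma cut_in_curve_cuts:
  assumes U: "U \<in> vertex_labels D" "boundary D U \<subseteq> nonalternating_edges D"
  shows "boundary D U \<in> boundary D ` curve_labels D"
proof -
  have unmarked: "mate D d \<in> U \<longleftrightarrow> d \<in> U" if "d \<in> darts D" "d \<notin> marked D" for d
  proof -
    have "{d, mate D d} \<notin> boundary D U"
      using that U(2) edge_in_nonalternating[of d] by auto
    then show ?thesis using edge_in_boundary[OF that(1), of U] by auto
  qed
  have "p \<in> U \<longleftrightarrow> q \<in> U" if pq: "joined D p q" for p q
  proof -
    obtain n where n: "q = (face_step D ^^ n) (rot D p)"
      "\<And>m. m < n \<Longrightarrow> (face_step D ^^ m) (rot D p) \<notin> marked D"
      using pq by (auto simp: joined_def)
    have p: "p \<in> darts D" using pq marked_closed by (auto simp: joined_def)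
    have "(face_step D ^^ m) (rot D p) \<in> U \<longleftrightarrow> p \<in> U" if "m \<le> n" for m
      using that
    proof (induction m)
      case 0
      then show ?case using vertex_labelsD[OF U(1) p] by simp
    next
      case (Suc m)
      let ?d = "(face_step D ^^ m) (rot D p)"
      have "?d \<in> darts D" using p by (simp add: face_step_power_closed rot_closed)
      moreover have "?d \<notin> marked D" using n(2) Suc.prems by simp
      ultimately have "face_step D ?d \<in> U \<longleftrightarrow> ?d \<in> U"
        using unmarked vertex_labelsD[OF U(1)] by (simp add: face_step_def mate_closed)
      then show ?case using Suc by simp
    qed
    then show ?thesis using n(1) by blast
  qed
  then have "U \<inter> marked D \<in> curve_labels D"
    by (auto simp: curve_labels_def joined_def)
  moreover have "boundary D (U \<inter> marked D) = boundary D U"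
    using unmarked marked_closed
    by (intro dedges_eqI boundary_subset) (auto simp: edge_in_boundary marked_mate_iff)
  ultimately show ?thesis by (metis imageI)
qed

text \<open>For the second inclusion, everything orthogonal to \<open>marked_cycles D\<close> is a
  cut within the non-alternating edges and hence a curve cut; then take the double
  complement.\<close>

lemma marked_cycles_eq_orth_curve_cuts:
  "marked_cycles D = orth (nonalternating_edges D) (boundary D ` curve_labels D)"
proof
  let ?N = "nonalternating_edges D"
  have fin: "finite ?N" using nonalternating_subset finite_dedges finite_subset by blast
  have sub: "subspace_of ?N (marked_cycles D)"
    unfolding marked_cycles_def
    using subspace_of_cycles by (rule subspace_of_image) (auto simp: sym_diff_Int)
  show "marked_cycles D \<subseteq> orth ?N (boundary D ` curve_labels D)"
    using marked_cycle_orth_curve_cut by (auto simp: orth_def marked_cycles_def)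
  show "orth ?N (boundary D ` curve_labels D) \<subseteq> marked_cycles D"
  proof
    fix x assume x: "x \<in> orth ?N (boundary D ` curve_labels D)"
    have "even (card (z \<inter> x))" if "z \<in> orth ?N (marked_cycles D)" for z
    proof -
      obtain U where "U \<in> vertex_labels D" "z = boundary D U" "z \<subseteq> ?N"
        using \<open>z \<in> _\<close> by (rule orth_marked_cycles_cut)
      then have "z \<in> boundary D ` curve_labels D"
        using cut_in_curve_cuts by simp
      then show ?thesis using x by (auto simp: orth_def)
    qed
    then have "x \<in> orth ?N (orth ?N (marked_cycles D))"
      using x by (auto simp: orth_def)
    then show "x \<in> marked_cycles D" using orth_orth[OF fin sub] by simp
  qed
qed

end

section \<open>Cycle spaces of multigraphs\<close>

text \<open>To be applied with \<open>f\<close> a graph isomorphism on edges, and with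
  \<open>f\<close> the map that forgets the component index of an edge.\<close>

lemma card_orth_image:
  assumes "inj_on f E" "W \<subseteq> Pow E"
  defines "C \<equiv> orth E W" and "C' \<equiv> orth (f ` E) ((`) f ` W)"
  shows "card C' = card C" "card (C' \<inter> orth (f ` E) C') = card (C \<inter> orth E C)"
proof -
  have inj: "inj_on ((`) f) (Pow E)"
    using assms(1) by (rule inj_on_image_Pow)
  have sub: "C \<subseteq> Pow E" "orth E C \<subseteq> Pow E"
    by (auto simp: C_def orth_def)
  have C': "C' = (`) f ` C"
    using assms(1,2) by (simp add: C_def C'_def orth_image)
  show "card C' = card C"
    unfolding C' using inj_on_subset[OF inj sub(1)] by (rule card_image)
  have "orth (f ` E) C' = (`) f ` orth E C"
    using assms(1) sub(1) by (simp add: C' orth_image)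
  then have "C' \<inter> orth (f ` E) C' = (`) f ` (C \<inter> orth E C)"
    using inj_on_image_Int[OF inj sub] by (simp add: C')
  moreover have "inj_on ((`) f) (C \<inter> orth E C)"
    using inj sub(1) by (meson inf.coboundedI1 inj_on_subset)
  ultimately show "card (C' \<inter> orth (f ` E) C') = card (C \<inter> orth E C)"
    by (simp add: card_image)
qed

text \<open>A loop has a single end and therefore lies in no cut.\<close>

definition edge_cut :: "('v, 'e) multigraph \<Rightarrow> 'v set \<Rightarrow> 'e set" where
  "edge_cut G U = {e \<in> edges G. ends G e \<inter> U \<noteq> {} \<and> \<not> ends G e \<subseteq> U}"

definition cycle_space :: "('v, 'e) multigraph \<Rightarrow> 'e set set" where
  "cycle_space G = orth (edges G) (edge_cut G ` Pow (verts G))"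

text \<open>The radical of the dot product on the cycle space; its codimension is the rank that
  gives twice the genus.\<close>

definition bicycle_space :: "('v, 'e) multigraph \<Rightarrow> 'e set set" where
  "bicycle_space G = cycle_space G \<inter> orth (edges G) (cycle_space G)"

lemma edge_cut_subset: "edge_cut G U \<subseteq> edges G"
  by (auto simp: edge_cut_def)

lemma edge_cuts_subset: "edge_cut G ` A \<subseteq> Pow (edges G)"
  by (auto simp: edge_cut_def)

lemma finite_cycle_space: "finite (edges G) \<Longrightarrow> finite (cycle_space G)"
  by (simp add: cycle_space_def orth_def)

lemma empty_in_cycle_space: "{} \<in> cycle_space G"
  by (simp add: cycle_space_def orth_def)

lemma empty_in_bicycle_space: "{} \<in> bicycle_space G"
  by (simp add: bicycle_space_def empty_in_cycle_space) (simp add: orth_def)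

text \<open>The vertex bijection is injective only on \<open>verts G\<close>, so all ends have to
  lie there for cuts to correspond to cuts.\<close>

lemma card_cycle_space_iso:
  assumes iso: "multigraph_iso G H" and ends: "\<And>e. e \<in> edges G \<Longrightarrow> ends G e \<subseteq> verts G"
  shows "card (cycle_space H) = card (cycle_space G)"
    and "card (bicycle_space H) = card (bicycle_space G)"
proof -
  obtain \<phi> \<psi> where \<phi>: "bij_betw \<phi> (verts G) (verts H)" and \<psi>: "bij_betw \<psi> (edges G) (edges H)"
    and e: "\<And>e. e \<in> edges G \<Longrightarrow> ends H (\<psi> e) = \<phi> ` ends G e"
    using iso by (auto simp: multigraph_iso_def)
  have inj: "inj_on \<phi> (verts G)" using \<phi> by (rule bij_betw_imp_inj_on)
  have E: "edges H = \<psi> ` edges G" using \<psi> by (simp add: bij_betw_imp_surj_on)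
  have V: "verts H = \<phi> ` verts G" using \<phi> by (simp add: bij_betw_imp_surj_on)
  have "edge_cut H (\<phi> ` U) = \<psi> ` edge_cut G U" if U: "U \<subseteq> verts G" for U
  proof -
    have "ends H (\<psi> x) \<inter> \<phi> ` U \<noteq> {} \<longleftrightarrow> ends G x \<inter> U \<noteq> {}"
      "ends H (\<psi> x) \<subseteq> \<phi> ` U \<longleftrightarrow> ends G x \<subseteq> U" if x: "x \<in> edges G" for x
    proof -
      show "ends H (\<psi> x) \<inter> \<phi> ` U \<noteq> {} \<longleftrightarrow> ends G x \<inter> U \<noteq> {}"
        unfolding e[OF x] inj_on_image_Int[OF inj ends[OF x] U, symmetric] by simp
      show "ends H (\<psi> x) \<subseteq> \<phi> ` U \<longleftrightarrow> ends G x \<subseteq> U"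
        unfolding e[OF x] image_subset_iff using inj_on_image_mem_iff[OF inj _ U] ends[OF x] by blast
    qed
    then have "edge_cut G U =
        {x \<in> edges G. ends H (\<psi> x) \<inter> \<phi> ` U \<noteq> {} \<and> \<not> ends H (\<psi> x) \<subseteq> \<phi> ` U}"
      unfolding edge_cut_def by (intro Collect_cong conj_cong refl) simp_all
    moreover have "{y \<in> \<psi> ` A. P y} = \<psi> ` {x \<in> A. P (\<psi> x)}" for A P by blast
    ultimately show ?thesis by (simp add: edge_cut_def[of H] E)
  qed
  moreover have "Pow (verts H) = (`) \<phi> ` Pow (verts G)"
    by (simp add: V image_Pow_surj)
  ultimately have "edge_cut H ` Pow (verts H) = (`) \<psi> ` edge_cut G ` Pow (verts G)"
    by (simp add: image_image)
  then show "card (cycle_space H) = card (cycle_space G)"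
    and "card (bicycle_space H) = card (bicycle_space G)"
    using card_orth_image[OF bij_betw_imp_inj_on[OF \<psi>] edge_cuts_subset, of "Pow (verts G)"]
    by (simp_all add: cycle_space_def bicycle_space_def E)
qed

section \<open>Vertices, edges and cuts of the alternating decomposition graph\<close>

lemma edges_connected_adg: "edges (connected_adg D) = nonalternating_edges D"
  by (auto simp: connected_adg_def alternating_def)

lemma face_step_component: "face_step (component D (Inl C)) = face_step D"
  by (simp add: face_step_def[abs_def])

definition dart_component :: "'d diagram \<Rightarrow> 'd \<Rightarrow> 'd set" where
  "dart_component D = class_of (darts D) (\<lambda>x y. y = rot D x \<or> y = mate D x)"

definition adg_vertex :: "'d diagram \<Rightarrow> 'd \<Rightarrow> ('d set + nat) \<times> 'd set" where
  "adg_vertex D p = (Inl (dart_component D p),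
    curve_through (component D (Inl (dart_component D p))) p)"

context link_diagram
begin

lemma marked_component: "C \<in> dart_components D \<Longrightarrow> marked (component D (Inl C)) = marked D \<inter> C"
  using dart_component_closed(1) by (auto simp: marked_def)

lemma face_step_power_component:
  assumes "C \<in> dart_components D" "d \<in> C"
  shows "(face_step D ^^ n) d \<in> C"
  by (induction n) (use assms dart_component_closed in \<open>auto simp: face_step_def\<close>)

lemma joined_component:
  assumes "C \<in> dart_components D"
  shows "joined (component D (Inl C)) p q \<longleftrightarrow> joined D p q \<and> p \<in> C"
proof (cases "p \<in> C")
  case True
  then have "(face_step D ^^ n) (rot D p) \<in> C" for n
    using assms face_step_power_component dart_component_closed(2) by blast
  then show ?thesis
    using True by (auto simp: joined_def marked_component[OF assms] face_step_component
        simp del: component.simps) (auto simp: component.simps)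
qed (auto simp: joined_def marked_component[OF assms] simp del: component.simps)

lemma dart_component_in: "d \<in> darts D \<Longrightarrow> dart_component D d \<in> dart_components D"
  by (simp add: dart_component_def dart_components_def classes_def)

lemma self_in_dart_component: "d \<in> dart_component D d"
  by (simp add: dart_component_def self_in_class_of)

lemma dart_component_eq: "C \<in> dart_components D \<Longrightarrow> d \<in> C \<Longrightarrow> dart_component D d = C"
  unfolding dart_component_def dart_components_def by (rule classes_eqI[symmetric])

lemma dart_component_mate: "d \<in> darts D \<Longrightarrow> dart_component D (mate D d) = dart_component D d"
  using dart_component_in dart_component_closed(3) self_in_dart_component
  by (intro dart_component_eq) auto

lemma adg_vertex_joined:
  assumes "joined D p q"
  shows "adg_vertex D p = adg_vertex D q"
proof -
  have p: "p \<in> darts D" "p \<in> marked D" "q \<in> marked D"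
    using assms marked_closed by (auto simp: joined_def)
  let ?C = "dart_component D p"
  have C: "?C \<in> dart_components D" "p \<in> ?C"
    using p dart_component_in self_in_dart_component by auto
  have "q \<in> ?C"
    using assms face_step_power_component[OF C(1) dart_component_closed(2)[OF C]]
    by (auto simp: joined_def)
  then have "dart_component D q = ?C" using C(1) by (simp add: dart_component_eq)
  moreover have "curve_through (component D (Inl ?C)) p = curve_through (component D (Inl ?C)) q"
    unfolding curve_through_def
    by (rule class_of_step)
      (use p C \<open>q \<in> ?C\<close> assms in \<open>simp_all add: marked_component joined_component del: component.simps\<close>)
  ultimately show ?thesis by (simp add: adg_vertex_def)
qed

text \<open>Marked points with the same vertex are linked by joined pairs within one component, and
  \<open>Y\<close> is constant along these. So curve labels are labels of vertices.\<close>

lemma curve_labels_adg_vertex: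
  assumes Y: "Y \<in> curve_labels D" and p: "p \<in> marked D" "q \<in> marked D"
    and eq: "adg_vertex D p = adg_vertex D q"
  shows "p \<in> Y \<longleftrightarrow> q \<in> Y"
proof -
  let ?C = "dart_component D p"
  have C: "?C \<in> dart_components D"
    using p marked_closed dart_component_in by blast
  have "q \<in> curve_through (component D (Inl ?C)) p"
  proof -
    have "curve_through (component D (Inl ?C)) p = curve_through (component D (Inl ?C)) q"
      using eq by (auto simp: adg_vertex_def simp del: component.simps)
    then show ?thesis by (simp add: curve_through_def self_in_class_of del: component.simps)
  qed
  then show ?thesis
    unfolding curve_through_def
    by (rule class_of_invariant)
      (use Y C in \<open>auto simp: joined_component curve_labels_def simp del: component.simps\<close>)
qed

lemma verts_adg:
  assumes "p \<in> marked D"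
  shows "adg_vertex D p \<in> verts (alternating_decomposition_graph D)"
proof -
  let ?C = "dart_component D p"
  have C: "?C \<in> dart_components D"
    using assms marked_closed dart_component_in by blast
  then have "p \<in> marked (component D (Inl ?C))"
    using assms self_in_dart_component by (simp add: marked_component del: component.simps)
  then have "curve_through (component D (Inl ?C)) p \<in> verts (connected_adg (component D (Inl ?C)))"
    by (auto simp: connected_adg_def alternating_def nonalternating_edges_def curves_def
        classes_def curve_through_def simp del: component.simps)
  then show ?thesis
    using C by (auto simp: alternating_decomposition_graph_def disjoint_union_def adg_vertex_def
        components_def simp del: component.simps)
qed

lemma edges_adg:
  "edges (alternating_decomposition_graph D) =
    (\<lambda>p. (Inl (dart_component D p), {p, mate D p})) ` marked D"
proof -
  have "nonalternating_edges (component D (Inl C)) = (\<lambda>p. {p, mate D p}) ` (marked D \<inter> C)"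
    if "C \<in> dart_components D" for C
    using marked_component[OF that] by (simp add: nonalternating_edges_def)
  moreover have "nonalternating_edges (component D (Inr i)) = {}" for i
    by (simp add: nonalternating_edges_def marked_def)
  \<comment> \<open>Crossingless circles contribute no edges, so only the \<open>Inl\<close> indices
    remain.\<close>
  ultimately have "edges (alternating_decomposition_graph D) =
      (SIGMA i:Inl ` dart_components D. (\<lambda>p. {p, mate D p}) ` (marked D \<inter> projl i))"
    by (auto simp: alternating_decomposition_graph_def disjoint_union_def components_def
        edges_connected_adg simp del: component.simps)
  also have "\<dots> = (\<lambda>p. (Inl (dart_component D p), {p, mate D p})) ` marked D" (is "?L = ?R")
  proof (intro equalityI subsetI)
    fix x assume "x \<in> ?L"
    then obtain C p where "C \<in> dart_components D" "p \<in> marked D" "p \<in> C" "x = (Inl C, {p, mate D p})"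
      by auto
    then show "x \<in> ?R" using dart_component_eq by (intro image_eqI[of _ _ p]) auto
  next
    fix x assume "x \<in> ?R"
    then obtain p where p: "p \<in> marked D" "x = (Inl (dart_component D p), {p, mate D p})" by auto
    then show "x \<in> ?L"
      using dart_component_in[of p] self_in_dart_component[of p] marked_closed by auto
  qed
  finally show ?thesis .
qed

lemma ends_adg:
  assumes "p \<in> marked D"
  shows "ends (alternating_decomposition_graph D) (Inl (dart_component D p), {p, mate D p}) =
    {adg_vertex D p, adg_vertex D (mate D p)}"
proof -
  let ?C = "dart_component D p"
  have p: "p \<in> darts D" using assms marked_closed by blast
  then have C: "?C \<in> dart_components D" by (rule dart_component_in)
  then have "p \<in> marked (component D (Inl ?C))"
    using assms self_in_dart_component by (simp add: marked_component del: component.simps)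
  \<comment> \<open>This excludes the branch of \<open>connected_adg\<close> in which
    \<open>ends\<close> has the default value \<open>{}\<close>.\<close>
  then have "\<not> alternating (component D (Inl ?C))"
    by (auto simp: alternating_def nonalternating_edges_def simp del: component.simps)
  then show ?thesis
    using dart_component_mate[OF p]
    by (simp add: alternating_decomposition_graph_def disjoint_union_def connected_adg_def
        adg_vertex_def del: component.simps)
qed

lemma ends_adg_subset:
  "e \<in> edges (alternating_decomposition_graph D) \<Longrightarrow>
    ends (alternating_decomposition_graph D) e \<subseteq> verts (alternating_decomposition_graph D)"
  using ends_adg verts_adg marked_closed by (auto simp: edges_adg)

lemma inj_on_snd_edges_adg: "inj_on snd (edges (alternating_decomposition_graph D))"
proof (rule inj_onI)
  fix e e' assume e: "e \<in> edges (alternating_decomposition_graph D)"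
    "e' \<in> edges (alternating_decomposition_graph D)" "snd e = snd e'"
  then obtain p q where pq: "e = (Inl (dart_component D p), {p, mate D p})"
    "e' = (Inl (dart_component D q), {q, mate D q})" "p \<in> darts D" "q \<in> darts D"
    using marked_closed by (auto simp: edges_adg)
  then have "p = q \<or> p = mate D q" using e(3) by (auto simp: doubleton_eq_iff)
  then show "e = e'" using pq e(3) dart_component_mate by auto
qed

text \<open>\<open>Y\<close> is the pullback of \<open>U\<close> to marked points, so an edge has
  exactly one end in \<open>U\<close> iff exactly one of its darts is in \<open>Y\<close>.\<close>

lemma snd_edge_cut_adg:
  assumes "Y = {p \<in> marked D. adg_vertex D p \<in> U}"
  shows "snd ` edge_cut (alternating_decomposition_graph D) U = boundary D Y"
proof (rule dedges_eqI[OF _ boundary_subset])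
  let ?G = "alternating_decomposition_graph D"
  let ?edge = "\<lambda>p. (Inl (dart_component D p), {p, mate D p})"
  have cut: "?edge p \<in> edge_cut ?G U \<longleftrightarrow> (p \<in> Y) \<noteq> (mate D p \<in> Y)" if "p \<in> marked D" for p
    using that marked_closed[OF that] by (auto simp: edge_cut_def edges_adg ends_adg assms)
  show "snd ` edge_cut ?G U \<subseteq> dedges D"
    using edge_cut_subset[of ?G U] marked_closed edge_in_dedges by (auto simp: edges_adg)
  fix d assume d: "d \<in> darts D"
  show "{d, mate D d} \<in> snd ` edge_cut ?G U \<longleftrightarrow> {d, mate D d} \<in> boundary D Y"
  proof
    assume "{d, mate D d} \<in> snd ` edge_cut ?G U"
    then obtain x where x: "x \<in> edge_cut ?G U" "snd x = {d, mate D d}" by auto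
    then have "x \<in> edges ?G" using edge_cut_subset[of ?G U] by blast
    then obtain p where p: "p \<in> marked D" "x = ?edge p" by (auto simp: edges_adg)
    then have "{p, mate D p} \<in> boundary D Y"
      using cut[OF p(1)] x(1) marked_closed[OF p(1)] by (simp add: edge_in_boundary)
    then show "{d, mate D d} \<in> boundary D Y" using x(2) p(2) by simp
  next
    assume b: "{d, mate D d} \<in> boundary D Y"
    then have *: "(d \<in> Y) \<noteq> (mate D d \<in> Y)" using d by (simp add: edge_in_boundary)
    then have "d \<in> marked D" using d marked_mate_iff assms by auto
    then have "?edge d \<in> edge_cut ?G U" using * cut by simp
    then show "{d, mate D d} \<in> snd ` edge_cut ?G U" by (metis imageI snd_conv)
  qed
qed

text \<open>Pullbacks of vertex sets are curve labels, and every curve label \<open>Y\<close> is the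
  pullback of the set of vertices that it meets.\<close>

lemma snd_edge_cuts_adg:
  "(`) snd ` edge_cut (alternating_decomposition_graph D) `
      Pow (verts (alternating_decomposition_graph D)) = boundary D ` curve_labels D"
proof (intro equalityI subsetI)
  let ?G = "alternating_decomposition_graph D"
  fix x assume "x \<in> (`) snd ` edge_cut ?G ` Pow (verts ?G)"
  then obtain U where U: "x = snd ` edge_cut ?G U" by auto
  let ?Y = "{p \<in> marked D. adg_vertex D p \<in> U}"
  have "?Y \<in> curve_labels D"
    unfolding curve_labels_def
  proof (intro CollectI conjI allI impI)
    fix p q assume "joined D p q"
    then have "p \<in> marked D" "q \<in> marked D" "adg_vertex D p = adg_vertex D q"
      using adg_vertex_joined by (auto simp: joined_def)
    then show "p \<in> ?Y \<longleftrightarrow> q \<in> ?Y" by simp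
  qed auto
  then show "x \<in> boundary D ` curve_labels D"
    using snd_edge_cut_adg[OF refl, of U] U by simp
next
  let ?G = "alternating_decomposition_graph D"
  fix x assume "x \<in> boundary D ` curve_labels D"
  then obtain Y where Y: "Y \<in> curve_labels D" "x = boundary D Y" by auto
  have sub: "Y \<subseteq> marked D" using Y by (simp add: curve_labels_def)
  have "p \<in> Y" if "p \<in> marked D" "adg_vertex D p \<in> adg_vertex D ` Y" for p
    using that curve_labels_adg_vertex[OF Y(1)] sub by blast
  then have "Y = {p \<in> marked D. adg_vertex D p \<in> adg_vertex D ` Y}"
    using sub by auto
  then have "snd ` edge_cut ?G (adg_vertex D ` Y) = x"
    using snd_edge_cut_adg Y(2) by blast
  moreover have "adg_vertex D ` Y \<in> Pow (verts ?G)"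
    using sub verts_adg by blast
  ultimately show "x \<in> (`) snd ` edge_cut ?G ` Pow (verts ?G)" by blast
qed

lemma card_cycle_space_adg:
  "card (cycle_space (alternating_decomposition_graph D)) = card (marked_cycles D)"
  "card (bicycle_space (alternating_decomposition_graph D)) =
    card (marked_cycles D \<inter> orth (nonalternating_edges D) (marked_cycles D))"
proof -
  let ?G = "alternating_decomposition_graph D"
  have "snd ` edges ?G = nonalternating_edges D"
    by (simp add: edges_adg nonalternating_edges_def image_image)
  then show "card (cycle_space ?G) = card (marked_cycles D)"
    "card (bicycle_space ?G) =
      card (marked_cycles D \<inter> orth (nonalternating_edges D) (marked_cycles D))"
    using card_orth_image[OF inj_on_snd_edges_adg edge_cuts_subset, of "Pow (verts ?G)"]
    by (simp_all add: snd_edge_cuts_adg marked_cycles_eq_orth_curve_cuts cycle_space_def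
        bicycle_space_def)
qed

section \<open>The genus as an invariant of the graph\<close>

lemma finite_edges_adg: "finite (edges (alternating_decomposition_graph D))"
proof -
  have "finite (marked D)" using finite_darts by (simp add: marked_def)
  then show ?thesis by (simp add: edges_adg)
qed

text \<open>Each crossingless circle counts twice through the components and once in each of the two
  states, so circles cancel.\<close>

lemma turaev_genus_components:
  "2 * turaev_genus D = of_nat (card (crossings D) + 2 * card (dart_components D))
    - of_nat (card (A_state D) + card (B_state D))"
proof -
  have "card (components D) = card (dart_components D) + circles D"
    by (simp add: components_def card_Plus finite_dart_components)
  then show ?thesis by (simp add: turaev_genus_def num_A_def num_B_def)
qed

text \<open>This is \<open>card_marked_cycles\<close> read on the graph. The exponent is real
  because \<open>turaev_genus\<close> is a rational number by definition.\<close>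

lemma power_turaev_genus:
  "2 powr (2 * real_of_rat (turaev_genus D)) * card (bicycle_space (alternating_decomposition_graph D)) =
    card (cycle_space (alternating_decomposition_graph D))"
proof -
  define s where "s = card (A_state D) + card (B_state D)"
  define f where "f = card (crossings D) + 2 * card (dart_components D)"
  have "2 * real_of_rat (turaev_genus D) = of_rat (2 * turaev_genus D)"
    by (simp add: of_rat_mult)
  also have "\<dots> = real f - real s"
    unfolding turaev_genus_components s_def[symmetric] f_def[symmetric] by (simp add: of_rat_diff)
  finally have "2 powr (2 * real_of_rat (turaev_genus D)) = 2 ^ f / 2 ^ s"
    by (simp add: powr_diff powr_realpow)
  moreover have "2 ^ s * real (card (marked_cycles D)) =
      real (card (marked_cycles D \<inter> orth (nonalternating_edges D) (marked_cycles D))) * 2 ^ f"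
    using arg_cong[OF card_marked_cycles, of real] by (simp add: s_def f_def)
  ultimately show ?thesis
    by (simp add: card_cycle_space_adg divide_eq_eq mult_ac)
qed

end

theorem theorem1p1:
  fixes D1 :: "'a diagram" and D2 :: "'b diagram"
  assumes "link_diagram D1" and "link_diagram D2"
    and "multigraph_iso (alternating_decomposition_graph D1) (alternating_decomposition_graph D2)"
  shows "turaev_genus D1 = turaev_genus D2"
proof -
  interpret D1: link_diagram D1 by fact
  interpret D2: link_diagram D2 by fact
  let ?G = "alternating_decomposition_graph D1"
  have "finite (bicycle_space ?G)"
    using finite_cycle_space[OF D1.finite_edges_adg] by (simp add: bicycle_space_def)
  then have b: "real (card (bicycle_space ?G)) \<noteq> 0"
    using empty_in_bicycle_space[of ?G] by auto
  \<comment> \<open>Both sides are the cardinality of the cycle space, which the isomorphism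
    preserves, as it does that of the bicycle space.\<close>
  have "2 powr (2 * real_of_rat (turaev_genus D1)) * card (bicycle_space ?G) =
      2 powr (2 * real_of_rat (turaev_genus D2)) * card (bicycle_space ?G)"
    using D1.power_turaev_genus D2.power_turaev_genus card_cycle_space_iso[OF assms(3)]
      D1.ends_adg_subset by simp
  then show ?thesis using b by (simp add: powr_inj)
qed

end
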